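(* Let $X\in\mathbb{R}^{n\times p}$ have independent rows $X_i\sim\mathcal{N}_p(\mu_i,\sigma^2I_p)$, let $K^*$ be the number of distinct vectors among $\mu_1,\dots,\mu_n$ (the true clusters being the groups of indices sharing a common mean), and let $t^*=n-K^*+1$. Let $\mathcal{T}$ be the event that each of the merges $M^{(1)},\dots,M^{(t^*-1)}$ made by the randomized clustering algorithm joins two clusters whose union is contained in a single true cluster. Suppose the alpha-spending procedure of the context is run with total level $\alpha$ and a pre-specified sequence $\alpha_1,\dots,\alpha_{n-1}\ge 0$ with $\sum_{j=1}^{n-1}\alpha_j=\alpha$, producing $\widehat{K}$. Then $$\mathbb{P}\big(\{\widehat{K}>K^*\}\cap\mathcal{T}\big)\le\alpha.$$
   Context: Randomized agglomerative clustering: start with singletons; at step $s$, $\mathcal{M}^{(s)}$ is the set of pairs of distinct current clusters, $d(M;x)\ge0$ a linkage dissimilarity; given $X=x$ the merge $M^{(s)}$ is drawn with probability $p^{(s)}(M;x)=\exp(-d(M;x)/\tau^{(s)})/\sum_{M'\in\mathcal{M}^{(s)}}\exp(-d(M';x)/\tau^{(s)})$, with $\tau^{(s)}=\tau\,|\mathcal{M}^{(s)}|^{-1}\sum_{M'\in\mathcal{M}^{(s)}}d(M';x)>0$, $\tau>0$ fixed; merged clusters are replaced by their union; draws independent across steps given data; it is run until one cluster remains ($n-1$ merges). Let $m=(m^{(1)},\dots,m^{(n-1)})$ be the realized merges. P-value at step $t$ with $m^{(t)}=(C_1,C_2)$, $N=|C_1|+|C_2|\ge3$: let $\nu_i=\mathbb{1}\{i\in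 C_1\}/|C_1|-\mathbb{1}\{i\in C_2\}/|C_2|$, $B=\nu\nu^\top/\|\nu\|_2^2$, $W=(I_{C_1}-1_{C_1}1_{C_1}^\top/|C_1|)+(I_{C_2}-1_{C_2}1_{C_2}^\top/|C_2|)$ ($I_C$ the diagonal indicator matrix, $1_C$ the indicator vector), $R=(N-2)\|BX\|_F^2/\|WX\|_F^2$, $\mathcal{A}=(\eta,\gamma,\Delta,\Gamma)=(BX/\|BX\|_F,\ WX/\|WX\|_F,\ \|BX\|_F^2+\|WX\|_F^2,\ (I_n-B-W)X)$, $X(r;a)=\sqrt{\Delta_a}(\eta_a\sqrt{r/(N-2+r)}+\gamma_a\sqrt{(N-2)/(N-2+r)})+\Gamma_a$, and $$\mathbb{F}^{(t)}(r;a,m)=\frac{\int_0^r \ell_{F_{p,(N-2)p}}(r')\prod_{s=1}^t p^{(s)}(m^{(s)};X(r';a))\,dr'}{\int_0^\infty \ell_{F_{p,(N-2)p}}(r')\prod_{s=1}^t p^{(s)}(m^{(s)};X(r';a))\,dr'}$$ ($\ell_{F_{p,(N-2)p}}$ the $F$ density; $p^{(s)}(m^{(s)};x)$ uses the candidate set determined by $m^{(1)},\dots,m^{(s-1)}$). The p-value is $\mathbf{P}^{(t)}=1-\mathbb{F}^{(t)}(R;\mathcal{A},m)$ evaluated at the observed data; it tests $H_0^{(t)}:\mu_i=\mu_{i'}$ for all $i,i'\in C_1\cup C_2$. Alpha-spending procedure: inputs $\alpha$, $\alpha_1,\dots,\alpha_{n-1}$, the merges $m$, integers $n_{\min}\ge1$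 and $n^*$. Initialize the multiset $\mathcal{S}=\{\alpha_1,\dots,\alpha_{n-1}\}$. For $t=1,\dots,n-1$ with $m^{(t)}=(C_1,C_2)$: if $\min(|C_1|,|C_2|)\le n_{\min}$, no test is performed and one proceeds to step $t+1$. Otherwise set $\alpha^{(t)}=\min\mathcal{S}$ if $\min(|C_1|,|C_2|)\le n^*$ and $\alpha^{(t)}=\max\mathcal{S}$ otherwise, compute $\mathbf{P}^{(t)}$, remove $\alpha^{(t)}$ from $\mathcal{S}$, and if $\mathbf{P}^{(t)}<\alpha^{(t)}$, output $\widehat{K}=n-t+1$ and stop. If no rejection occurs, output $\widehat{K}=1$. *)

theory Defs
  imports "HOL-Probability.Probability" "HOL-Library.Multiset"
begin

text \<open>Data: an n x p real matrix, represented as real^'p^'n (row i is x$i).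
  Index types 'n (observations, n = CARD('n)) and 'p (variables, p = CARD('p)).
  Clusters are sets of row indices; a merge is the two-element set {C1, C2}.
  A merge sequence is a list m, with m ! (s-1) the merge made at step s.\<close>

definition singletons :: "'n set set" where
  "singletons = {{i} | i. True}"

definition cands :: "'n set set \<Rightarrow> 'n set set set" where
  "cands P = {{C1, C2} | C1 C2. C1 \<in> P \<and> C2 \<in> P \<and> C1 \<noteq> C2}"

definition merge_part :: "'n set set \<Rightarrow> 'n set set \<Rightarrow> 'n set set" where
  "merge_part P M = (P - M) \<union> {\<Union>M}"

fun parts :: "'n set set list \<Rightarrow> nat \<Rightarrow> 'n set set" where
  "parts m 0 = singletons"
| "parts m (Suc s) = merge_part (parts m s) (m ! s)"

definition temp :: "('n set set \<Rightarrow> real^'p^'n \<Rightarrow> real) \<Rightarrow> real \<Rightarrow> 'n set set \<Rightarrow> real^'p^'n \<Rightarrow> real" where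
  "temp d tau P x = tau * (\<Sum>M'\<in>cands P. d M' x) / real (card (cands P))"

definition merge_prob :: "('n set set \<Rightarrow> real^'p^'n \<Rightarrow> real) \<Rightarrow> real \<Rightarrow> 'n set set \<Rightarrow> 'n set set \<Rightarrow> real^'p^'n \<Rightarrow> real" where
  "merge_prob d tau P M x =
     (if M \<in> cands P then
        exp (- d M x / temp d tau P x) / (\<Sum>M'\<in>cands P. exp (- d M' x / temp d tau P x))
      else 0)"

definition seq_lik :: "('n set set \<Rightarrow> real^'p^'n \<Rightarrow> real) \<Rightarrow> real \<Rightarrow> 'n set set list \<Rightarrow> nat \<Rightarrow> real^'p^'n \<Rightarrow> real" where
  "seq_lik d tau m t x = (\<Prod>s<t. merge_prob d tau (parts m s) (m ! s) x)"

definition valid_seqs :: "'n set set list set" where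
  "valid_seqs = {m. length m = CARD('n) - 1 \<and> (\<forall>s < length m. m ! s \<in> cands (parts m s))}"

text \<open>Probability, given data x, that the realized merge sequence satisfies E
  (merges drawn independently across steps given the data).\<close>
definition alg_prob :: "('n set set \<Rightarrow> real^'p^'n \<Rightarrow> real) \<Rightarrow> real \<Rightarrow> real^'p^'n \<Rightarrow> ('n set set list \<Rightarrow> bool) \<Rightarrow> real" where
  "alg_prob d tau x E = (\<Sum>m\<in>{m \<in> valid_seqs. E m}. seq_lik d tau m (CARD('n) - 1) x)"

text \<open>The two clusters of a merge M = {C1, C2} (the p-value is symmetric in C1, C2).\<close>
definition cl1 :: "'n set set \<Rightarrow> 'n set" where "cl1 M = (SOME C. C \<in> M)"
definition cl2 :: "'n set set \<Rightarrow> 'n set" where "cl2 M = (SOME C. C \<in> M \<and> C \<noteq> cl1 M)"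

definition nuvec :: "'n set \<Rightarrow> 'n set \<Rightarrow> real^'n" where
  "nuvec C1 C2 = (\<chi> i. (if i \<in> C1 then 1 / real (card C1) else 0) - (if i \<in> C2 then 1 / real (card C2) else 0))"

definition Bmat :: "'n set \<Rightarrow> 'n set \<Rightarrow> real^'n^'n" where
  "Bmat C1 C2 = (\<chi> i k. (nuvec C1 C2 $ i) * (nuvec C1 C2 $ k) / (norm (nuvec C1 C2))\<^sup>2)"

definition center :: "'n set \<Rightarrow> real^'n^'n" where
  "center C = (\<chi> i k. (if i = k \<and> i \<in> C then 1 else 0) - (if i \<in> C \<and> k \<in> C then 1 / real (card C) else 0))"

definition Wmat :: "'n set \<Rightarrow> 'n set \<Rightarrow> real^'n^'n" where
  "Wmat C1 C2 = center C1 + center C2"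

definition F_density :: "real \<Rightarrow> real \<Rightarrow> real \<Rightarrow> real" where
  "F_density d1 d2 r = (if r > 0 then
      (d1 / d2) powr (d1 / 2) * r powr (d1 / 2 - 1) * (1 + d1 * r / d2) powr (- (d1 + d2) / 2)
        / Beta (d1 / 2) (d2 / 2)
    else 0)"

text \<open>X(r; a) for a = (eta, gamma, Delta, Gamma); N = |C1| + |C2|.\<close>
definition Xr :: "nat \<Rightarrow> (real^'p^'n) \<times> (real^'p^'n) \<times> real \<times> (real^'p^'n) \<Rightarrow> real \<Rightarrow> real^'p^'n" where
  "Xr N a r = (case a of (eta, gam, Del, Gam) \<Rightarrow>
      sqrt Del *\<^sub>R (sqrt (r / (real N - 2 + r)) *\<^sub>R eta + sqrt ((real N - 2) / (real N - 2 + r)) *\<^sub>R gam) + Gam)"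

definition Fcdf :: "('n set set \<Rightarrow> real^'p^'n \<Rightarrow> real) \<Rightarrow> real \<Rightarrow> 'n set set list \<Rightarrow> nat \<Rightarrow> nat
     \<Rightarrow> (real^'p^'n) \<times> (real^'p^'n) \<times> real \<times> (real^'p^'n) \<Rightarrow> real \<Rightarrow> real" where
  "Fcdf d tau m t N a r =
     (let g = (\<lambda>r'. F_density (real CARD('p)) ((real N - 2) * real CARD('p)) r' * seq_lik d tau m t (Xr N a r'))
      in (LINT r':{0..r}|lborel. g r') / (LINT r':{0..}|lborel. g r'))"

text \<open>The p-value P^(t) (t is 1-based: the merge tested is m ! (t - 1)).\<close>
definition pvalue :: "('n set set \<Rightarrow> real^'p^'n \<Rightarrow> real) \<Rightarrow> real \<Rightarrow> 'n set set list \<Rightarrow> nat \<Rightarrow> real^'p^'n \<Rightarrow> real" where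
  "pvalue d tau m t x =
     (let M = m ! (t - 1); C1 = cl1 M; C2 = cl2 M; N = card C1 + card C2;
          BX = Bmat C1 C2 ** x; WX = Wmat C1 C2 ** x;
          R = (real N - 2) * (norm BX)\<^sup>2 / (norm WX)\<^sup>2;
          a = (BX /\<^sub>R norm BX, WX /\<^sub>R norm WX, (norm BX)\<^sup>2 + (norm WX)\<^sup>2, x - BX - WX)
      in 1 - Fcdf d tau m t N a R)"

text \<open>Alpha-spending procedure. Arguments: p-value function pv (indexed by 1-based step),
  merges m, n_min, n^*, n, remaining steps k, current step t, multiset S.\<close>
fun spend :: "(nat \<Rightarrow> real) \<Rightarrow> 'n set set list \<Rightarrow> nat \<Rightarrow> int \<Rightarrow> nat \<Rightarrow> nat \<Rightarrow> nat \<Rightarrow> real multiset \<Rightarrow> nat" where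
  "spend pv m nmin nstar n 0 t S = 1"
| "spend pv m nmin nstar n (Suc k) t S =
     (let M = m ! (t - 1); mn = min (card (cl1 M)) (card (cl2 M)) in
      if mn \<le> nmin then spend pv m nmin nstar n k (t + 1) S
      else (let a = (if int mn \<le> nstar then Min (set_mset S) else Max (set_mset S)) in
            if pv t < a then n - t + 1 else spend pv m nmin nstar n k (t + 1) (S - {#a#})))"

definition Khat :: "('n set set \<Rightarrow> real^'p^'n \<Rightarrow> real) \<Rightarrow> real \<Rightarrow> (nat \<Rightarrow> real) \<Rightarrow> nat \<Rightarrow> int
     \<Rightarrow> 'n set set list \<Rightarrow> real^'p^'n \<Rightarrow> nat" where
  "Khat d tau alphas nmin nstar m x =
     spend (\<lambda>t. pvalue d tau m t x) m nmin nstar CARD('n) (CARD('n) - 1) 1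
           (mset (map alphas [1..<CARD('n)]))"

text \<open>Law of X: independent entries X_ij ~ N(mu_ij, sig^2), i.e. rows N_p(mu_i, sig^2 I_p).\<close>
definition gauss_data :: "real^'p^'n \<Rightarrow> real \<Rightarrow> (real^'p^'n) measure" where
  "gauss_data mu sig = density lborel (\<lambda>x. \<Prod>i\<in>UNIV. \<Prod>j\<in>UNIV. normal_density (mu $ i $ j) sig (x $ i $ j))"

definition Kstar :: "real^'p^'n \<Rightarrow> nat" where
  "Kstar mu = card (range (\<lambda>i. mu $ i))"

definition good_merges :: "real^'p^'n \<Rightarrow> 'n set set list \<Rightarrow> bool" where
  "good_merges mu m = (\<forall>s < CARD('n) - Kstar mu. \<exists>k. \<Union>(m ! s) \<subseteq> {i. mu $ i = mu $ k})"

end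

theory Submission
  imports Defs
begin

text \<open>Under the null hypothesis for \<open>C1 \<union> C2\<close> the Gaussian density is constant along the curves
  \<open>r \<mapsto> X(r; a)\<close>. So validity of the p-value given the first \<open>t\<close> merges reduces to a statement
  about Lebesgue measure, namely that it disintegrates along these curves with the \<open>F\<close> kernel in \<open>r\<close>, up
  to a constant that cancels. No polar coordinates are needed: inserting a weight in \<open>\<parallel>B x\<parallel>\<close> and applying
  Fubini's theorem to the scalings of the ranges of \<open>W\<close> and \<open>B\<close>, whose Jacobians are
  \<open>u ^ ((N - 2) p)\<close> and \<open>u ^ p\<close>, produces the kernel. On a single curve the claim is that a
  distribution function, evaluated at its own variable, is superuniform.

  On the event of the theorem a rejection with \<open>Khat > Kstar\<close> happens at a step whose null hypothesis is
  true. Since the level used at a step depends only on the merges made so far, a union bound over the merge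
  tree charges each rejection to the element removed from the multiset of levels.\<close>

section \<open>Linear changes of variables\<close>

text \<open>The obstacle is that \<open>fibre r x\<close> forgets \<open>norm (B x)\<close>: the
  point \<open>x\<close> that labels a curve carries one redundant radius, over which an unweighted
  integral would diverge. \<open>fibre_weight\<close> confines this radius to \<open>[1, e]\<close>,
  a window of length one on the logarithmic scale, on which scalings of the range of
  \<open>B\<close> act by translation, so the window finally integrates to 1. The p-value is a ratio
  of integrals, hence the remaining constant \<open>2 * c powr (k / 2)\<close> and the normalisation
  of the F density never have to be matched. The selection probability of the merges enters both the
  law of the data and the integrand of the p-value; on one curve this makes the two measures in
  \<open>r\<close> proportional, which is all that superuniformity asks for. The link with the event
  of the theorem is arithmetic: rejecting at step \<open>t\<close> outputs \<open>n - t + 1\<close>,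
  which exceeds \<open>Kstar mu\<close> exactly when \<open>t \<le> n - Kstar mu\<close>.\<close>

lemma nn_integral_lborel_translate:
  fixes F :: "'a::euclidean_space \<Rightarrow> ennreal"
  assumes [measurable]: "F \<in> borel_measurable borel"
  shows "(\<integral>\<^sup>+ x. F (a + x) \<partial>lborel) = (\<integral>\<^sup>+ x. F x \<partial>lborel)"
proof -
  have "(\<integral>\<^sup>+ x. F x \<partial>lborel) = (\<integral>\<^sup>+ x. F x \<partial>distr lborel borel ((+) a))"
    by (simp add: lborel_distr_plus)
  also have "\<dots> = (\<integral>\<^sup>+ x. F (a + x) \<partial>lborel)"
    by (subst nn_integral_distr) auto
  finally show ?thesis ..
qed

lemma nn_integral_lborel_reflect:
  fixes F :: "'a::euclidean_space \<Rightarrow> ennreal"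
  assumes [measurable]: "F \<in> borel_measurable borel"
  shows "(\<integral>\<^sup>+ x. F (a - x) \<partial>lborel) = (\<integral>\<^sup>+ x. F x \<partial>lborel)"
proof -
  have "(\<integral>\<^sup>+ x. F x \<partial>lborel)
      = (\<integral>\<^sup>+ x. F x \<partial>density (distr lborel borel (\<lambda>x. a + (-1) *\<^sub>R x)) (\<lambda>_. ennreal (\<bar>-1\<bar>^DIM('a))))"
    by (subst lborel_affine[of "-1" a]) auto
  also have "\<dots> = (\<integral>\<^sup>+ x. F (a - x) \<partial>lborel)"
    by (subst nn_integral_density, simp, simp) (subst nn_integral_distr, auto)
  finally show ?thesis ..
qed

lemma nn_integral_lborel_swap:
  fixes F :: "'a::euclidean_space \<Rightarrow> 'b::euclidean_space \<Rightarrow> ennreal"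
  assumes "(\<lambda>(x, y). F x y) \<in> borel_measurable borel"
  shows "(\<integral>\<^sup>+ x. \<integral>\<^sup>+ y. F x y \<partial>lborel \<partial>lborel) = (\<integral>\<^sup>+ y. \<integral>\<^sup>+ x. F x y \<partial>lborel \<partial>lborel)"
proof -
  have "pair_sigma_finite (lborel :: 'b measure) (lborel :: 'a measure)" ..
  moreover have "(\<lambda>(y, x). F x y) \<in> borel_measurable (lborel \<Otimes>\<^sub>M lborel)"
    using measurable_compose[OF measurable_pair_swap' assms[folded borel_prod]]
    by (simp add: split_beta')
  ultimately show ?thesis
    by (rule pair_sigma_finite.Fubini')
qed

lemma linear_borel_measurable:
  fixes T :: "'a::euclidean_space \<Rightarrow> 'b::euclidean_space"
  assumes "linear T"
  shows "T \<in> borel_measurable borel"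
  by (intro borel_measurable_continuous_onI linear_continuous_on)
     (simp add: assms linear_conv_bounded_linear[symmetric])

text \<open>Uniqueness of translation invariant measures: for fixed \<open>T\<close>, the functionals \<open>\<integral> f\<close> and
  \<open>\<integral> f \<circ> T\<close> are proportional, by evaluating \<open>\<integral>\<integral> f x * g (T y + x)\<close> in both orders.\<close>

lemma nn_integral_linear_proportional:
  fixes T :: "'a::euclidean_space \<Rightarrow> 'a" and f g :: "'a \<Rightarrow> ennreal"
  assumes lin: "linear T" and bij: "bij T"
    and f[measurable]: "f \<in> borel_measurable borel" and g[measurable]: "g \<in> borel_measurable borel"
  shows "(\<integral>\<^sup>+ x. f x \<partial>lborel) * (\<integral>\<^sup>+ y. g (T y) \<partial>lborel)
       = (\<integral>\<^sup>+ x. g x \<partial>lborel) * (\<integral>\<^sup>+ y. f (T y) \<partial>lborel)"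
proof -
  have [measurable]: "T \<in> borel_measurable borel" by (rule linear_borel_measurable[OF lin])
  define U where "U = inv T"
  have TU[simp]: "T (U x) = x" for x
    by (simp add: U_def bij bij_is_surj surj_f_inv_f)
  have add: "T (a + b) = T a + T b" "T (a - b) = T a - T b" for a b
    using lin by (simp_all add: linear_add linear_diff)
  have "(\<integral>\<^sup>+ x. f x \<partial>lborel) * (\<integral>\<^sup>+ y. g (T y) \<partial>lborel)
      = (\<integral>\<^sup>+ x. f x * (\<integral>\<^sup>+ y. g (T y) \<partial>lborel) \<partial>lborel)"
    by (simp add: nn_integral_multc)
  \<comment> \<open>For fixed \<open>x\<close>, translating \<open>y\<close> by the preimage
    \<open>U x\<close> changes \<open>T y\<close> into \<open>T y + x\<close>.\<close>
  also have "\<dots> = (\<integral>\<^sup>+ x. \<integral>\<^sup>+ y. f x * g (T y + x) \<partial>lborel \<partial>lborel)"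
  proof (rule nn_integral_cong)
    fix x
    have "(\<integral>\<^sup>+ y. g (T y) \<partial>lborel) = (\<integral>\<^sup>+ y. g (T (U x + y)) \<partial>lborel)"
      by (intro nn_integral_lborel_translate[symmetric]) measurable
    then show "f x * (\<integral>\<^sup>+ y. g (T y) \<partial>lborel) = (\<integral>\<^sup>+ y. f x * g (T y + x) \<partial>lborel)"
      by (simp add: nn_integral_cmult add add.commute)
  qed
  also have "\<dots> = (\<integral>\<^sup>+ y. \<integral>\<^sup>+ x. f x * g (T y + x) \<partial>lborel \<partial>lborel)"
    by (rule nn_integral_lborel_swap) (simp add: borel_prod[symmetric])
  also have "\<dots> = (\<integral>\<^sup>+ y. \<integral>\<^sup>+ x. f (x - T y) * g x \<partial>lborel \<partial>lborel)"
  proof (rule nn_integral_cong)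
    fix y
    have "(\<integral>\<^sup>+ x. f (- T y + (T y + x)) * g (T y + x) \<partial>lborel) = (\<integral>\<^sup>+ x. f (- T y + x) * g x \<partial>lborel)"
      by (rule nn_integral_lborel_translate[of "\<lambda>x. f (- T y + x) * g x" "T y"]) measurable
    then show "(\<integral>\<^sup>+ x. f x * g (T y + x) \<partial>lborel) = (\<integral>\<^sup>+ x. f (x - T y) * g x \<partial>lborel)"
      by simp
  qed
  also have "\<dots> = (\<integral>\<^sup>+ x. \<integral>\<^sup>+ y. f (x - T y) * g x \<partial>lborel \<partial>lborel)"
    by (rule nn_integral_lborel_swap) (simp add: borel_prod[symmetric])
  \<comment> \<open>For fixed \<open>x\<close>, the reflection of \<open>y\<close> to
    \<open>U x - y\<close> turns \<open>x - T y\<close> into \<open>T y\<close>.\<close>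
  also have "\<dots> = (\<integral>\<^sup>+ x. g x * (\<integral>\<^sup>+ y. f (T y) \<partial>lborel) \<partial>lborel)"
  proof (rule nn_integral_cong)
    fix x
    have "(\<integral>\<^sup>+ y. f (T (U x - y)) \<partial>lborel) = (\<integral>\<^sup>+ y. f (T y) \<partial>lborel)"
      by (rule nn_integral_lborel_reflect) measurable
    then show "(\<integral>\<^sup>+ y. f (x - T y) * g x \<partial>lborel) = g x * (\<integral>\<^sup>+ y. f (T y) \<partial>lborel)"
      by (simp add: nn_integral_cmult add mult.commute)
  qed
  finally show ?thesis
    by (simp add: nn_integral_multc)
qed

text \<open>Testing the proportionality on the unit ball, whose volume is neither 0 nor infinite,
  determines the factor by division. It is not identified with a determinant, because it cancels
  when it is used.\<close>

lemma nn_integral_linear_bij: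
  fixes T :: "'a::euclidean_space \<Rightarrow> 'a"
  assumes lin: "linear T" and bij: "bij T"
  obtains c :: ennreal where "\<And>F. F \<in> borel_measurable borel \<Longrightarrow>
    (\<integral>\<^sup>+ x. F (T x) \<partial>lborel) = c * (\<integral>\<^sup>+ x. F x \<partial>lborel)"
proof
  fix F :: "'a \<Rightarrow> ennreal" assume F: "F \<in> borel_measurable borel"
  define f :: "'a \<Rightarrow> ennreal" where "f = indicator (ball 0 1)"
  define V where "V = (\<integral>\<^sup>+ x. f x \<partial>lborel)"
  have V: "V = emeasure lborel (ball (0::'a) 1)"
    by (simp add: V_def f_def)
  have "V > 0" unfolding V
    using emeasure_lborel_ball_finite[of "0::'a" 1]
    by (simp add: emeasure_ball unit_ball_vol_pos)
  moreover have "V < \<top>" unfolding V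
    using emeasure_lborel_ball_finite[of "0::'a" 1] by (simp add: infinity_ennreal_def)
  ultimately have V0: "V \<noteq> 0" "V \<noteq> \<top>" by auto
  have "V * (\<integral>\<^sup>+ y. F (T y) \<partial>lborel) = (\<integral>\<^sup>+ x. F x \<partial>lborel) * (\<integral>\<^sup>+ y. f (T y) \<partial>lborel)"
    unfolding V_def
    by (rule nn_integral_linear_proportional[OF lin bij _ F])
       (simp add: f_def borel_measurable_indicator)
  then have "(\<integral>\<^sup>+ y. F (T y) \<partial>lborel) = (\<integral>\<^sup>+ x. F x \<partial>lborel) * (\<integral>\<^sup>+ y. f (T y) \<partial>lborel) / V"
    by (metis V0 ennreal_mult_divide_eq mult.commute)
  then show "(\<integral>\<^sup>+ y. F (T y) \<partial>lborel) = ((\<integral>\<^sup>+ y. indicator (ball 0 1) (T y) \<partial>lborel)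
      / emeasure lborel (ball (0::'a) 1)) * (\<integral>\<^sup>+ x. F x \<partial>lborel)"
    by (simp add: f_def V mult.commute ennreal_times_divide)
qed

text \<open>A map that takes the form \<open>D\<close> in the coordinates \<open>T\<close> has the
  Jacobian of \<open>D\<close>: the unknown factor \<open>c\<close> of \<open>T\<close> comes out
  when \<open>T\<close> is removed and goes back in when \<open>T\<close> is restored.\<close>

lemma nn_integral_conjugate:
  fixes S D T :: "'a::euclidean_space \<Rightarrow> 'a" and F :: "'a \<Rightarrow> ennreal"
  assumes lin: "linear T" and inj: "inj T" and linD: "linear D"
    and TS: "\<And>x. T (S x) = D (T x)"
    and D: "\<And>F. F \<in> borel_measurable borel \<Longrightarrow> (\<integral>\<^sup>+ x. F (D x) \<partial>lborel) = \<delta> * (\<integral>\<^sup>+ x. F x \<partial>lborel)"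
    and F: "F \<in> borel_measurable borel"
  shows "(\<integral>\<^sup>+ x. F (S x) \<partial>lborel) = \<delta> * (\<integral>\<^sup>+ x. F x \<partial>lborel)"
proof -
  have surj: "surj T" by (rule linear_injective_imp_surjective[OF lin inj]) simp
  have bij: "bij T" using inj surj by (simp add: bij_def)
  obtain U where U: "linear U" and "U \<circ> T = id"
    using linear_injective_left_inverse[OF lin inj] by blast
  then have UT: "U (T x) = x" for x by (metis comp_apply id_apply)
  have [measurable]: "U \<in> borel_measurable borel" "D \<in> borel_measurable borel" "T \<in> borel_measurable borel"
    using U linD lin by (auto intro: linear_borel_measurable)
  note [measurable] = F
  obtain c where c: "\<And>F. F \<in> borel_measurable borel \<Longrightarrow>
    (\<integral>\<^sup>+ x. F (T x) \<partial>lborel) = c * (\<integral>\<^sup>+ x. F x \<partial>lborel)"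
    using nn_integral_linear_bij[OF lin bij] by blast
  have "(\<integral>\<^sup>+ x. F (S x) \<partial>lborel) = (\<integral>\<^sup>+ x. F (U (D (T x))) \<partial>lborel)"
    by (simp add: TS[symmetric] UT)
  also have "\<dots> = c * (\<integral>\<^sup>+ x. F (U (D x)) \<partial>lborel)"
    by (rule c[of "\<lambda>x. F (U (D x))"]) measurable
  also have "(\<integral>\<^sup>+ x. F (U (D x)) \<partial>lborel) = \<delta> * (\<integral>\<^sup>+ x. F (U x) \<partial>lborel)"
    by (rule D[of "\<lambda>x. F (U x)"]) measurable
  also have "c * (\<delta> * (\<integral>\<^sup>+ x. F (U x) \<partial>lborel)) = \<delta> * (c * (\<integral>\<^sup>+ x. F (U x) \<partial>lborel))"
    by (simp add: mult.left_commute)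
  also have "c * (\<integral>\<^sup>+ x. F (U x) \<partial>lborel) = (\<integral>\<^sup>+ x. F (U (T x)) \<partial>lborel)"
    by (rule c[of "\<lambda>x. F (U x)", symmetric]) measurable
  finally show ?thesis by (simp add: UT)
qed

text \<open>The substitution \<open>r = exp s\<close> is made on compact windows; both half-open and
  full lines are exhausted by windows, and monotone convergence passes to the limit.\<close>

lemma nn_integral_exp_substitution:
  fixes q :: "real \<Rightarrow> ennreal"
  assumes [measurable]: "q \<in> borel_measurable borel"
  shows "(\<integral>\<^sup>+ r. indicator {0<..} r * q r \<partial>lborel) = (\<integral>\<^sup>+ s. q (exp s) * ennreal (exp s) \<partial>lborel)"
proof -
  have ind: "(\<Squnion>n. indicator (A n) x) = (indicator (\<Union>n. A n) x :: ennreal)" for A :: "nat \<Rightarrow> real set" and x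
    by (auto simp: indicator_def SUP_eq_const intro!: antisym SUP_least SUP_upper2)
  have inc_ind: "incseq (\<lambda>n r. h r * indicator (A n) r)"
    if "incseq A" for h :: "real \<Rightarrow> ennreal" and A :: "nat \<Rightarrow> real set"
  proof (intro incseq_SucI le_funI)
    fix n r
    from that have "A n \<subseteq> A (Suc n)" by (rule incseq_SucD)
    then show "h r * indicator (A n) r \<le> h r * indicator (A (Suc n)) r"
      by (auto split: split_indicator)
  qed
  have inc: "incseq (\<lambda>n::nat. {- real n .. real n})" 
    by (auto simp: incseq_def)
  have inc2: "incseq (\<lambda>n::nat. {exp (- real n) .. exp (real n)})" 
    by (auto simp: incseq_def intro: order_trans[rotated])
  have un: "(\<Union>n::nat. {- real n .. real n}) = UNIV"
  proof -
    have "\<exists>n::nat. - real n \<le> x \<and> x \<le> real n" for x :: real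
    proof -
      obtain n :: nat where "\<bar>x\<bar> \<le> real n" using real_arch_simple by blast
      then show ?thesis by (intro exI[of _ n] conjI) linarith+
    qed
    then show ?thesis by auto
  qed
  have un2: "(\<Union>n::nat. {exp (- real n) .. exp (real n)}) = {0<..}"
  proof -
    have "\<exists>n::nat. exp (- real n) \<le> x \<and> x \<le> exp (real n)" if "x > 0" for x :: real
    proof -
      from un have "ln x \<in> (\<Union>n::nat. {- real n .. real n})" by simp
      then obtain n :: nat where "- real n \<le> ln x" "ln x \<le> real n" by auto
      with that show ?thesis
        by (metis exp_le_cancel_iff exp_ln)
    qed
    moreover have "0 < x" if "exp (- real n) \<le> x" for x n
      using that exp_gt_zero[of "- real n"] by linarith
    ultimately show ?thesis by auto
  qed
  have "(\<integral>\<^sup>+ r. indicator {0<..} r * q r \<partial>lborel)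
      = (\<integral>\<^sup>+ r. (\<Squnion>n::nat. q r * indicator {exp (- real n) .. exp (real n)} r) \<partial>lborel)"
    unfolding un2[symmetric] ind[symmetric]
    by (simp add: SUP_mult_left_ennreal mult.commute)
  also have "\<dots> = (\<Squnion>n::nat. \<integral>\<^sup>+ r. q r * indicator {exp (- real n) .. exp (real n)} r \<partial>lborel)"
    by (intro nn_integral_monotone_convergence_SUP inc_ind[OF inc2]) simp
  also have "\<dots> = (\<Squnion>n::nat. \<integral>\<^sup>+ s. q (exp s) * ennreal (exp s) * indicator {- real n .. real n} s \<partial>lborel)"
  proof (intro SUP_cong refl)
    fix n :: nat
    show "(\<integral>\<^sup>+ r. q r * indicator {exp (- real n) .. exp (real n)} r \<partial>lborel)
        = (\<integral>\<^sup>+ s. q (exp s) * ennreal (exp s) * indicator {- real n .. real n} s \<partial>lborel)"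
    \<comment> \<open>The window for \<open>n = 0\<close> is a single point, where both integrals
      vanish; the substitution rule serves the windows of positive length.\<close>
    proof (cases "n = 0")
      case True
      have "AE s in lborel. s \<noteq> (0::real)" "AE s in lborel. s \<noteq> (1::real)"
        by (rule AE_lborel_singleton)+
      then have "(\<integral>\<^sup>+ r. q r * indicator {1 .. 1} r \<partial>lborel) = (\<integral>\<^sup>+ r. 0 \<partial>(lborel :: real measure))"
        "(\<integral>\<^sup>+ s. q (exp s) * ennreal (exp s) * indicator {0 .. 0} s \<partial>lborel) = (\<integral>\<^sup>+ r. 0 \<partial>(lborel :: real measure))"
        by (auto intro!: nn_integral_cong_AE)
      then show ?thesis using True by simp
    next
      case False
      then show ?thesis
        by (intro nn_integral_substitution_aux)
           (auto intro!: derivative_eq_intros continuous_intros)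
    qed
  qed
  also have "\<dots> = (\<integral>\<^sup>+ s. (\<Squnion>n::nat. q (exp s) * ennreal (exp s) * indicator {- real n .. real n} s) \<partial>lborel)"
    by (intro nn_integral_monotone_convergence_SUP[symmetric] inc_ind[OF inc]) simp
  also have "\<dots> = (\<integral>\<^sup>+ s. q (exp s) * ennreal (exp s) * indicator (\<Union>n::nat. {- real n .. real n}) s \<partial>lborel)"
    unfolding ind[symmetric] by (simp only: SUP_mult_left_ennreal)
  finally show ?thesis by (simp add: un)
qed

section \<open>Disintegration of Lebesgue measure along the fibres\<close>

text \<open>Two mutually annihilating projections with the Jacobians of scaling their ranges. In the
  application \<open>k = p\<close> is the dimension of the range of \<open>B\<close> and
  \<open>c = N - 2\<close>, so \<open>c * k\<close> is that of \<open>W\<close>; these are the two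
  degrees of freedom of the F law. Orthogonality enters only later, with the Gaussian
  density.\<close>

locale projection_pair =
  fixes B W :: "'a::euclidean_space \<Rightarrow> 'a" and k c :: real
  assumes linB: "linear B" and linW: "linear W"
    and BB: "B (B x) = B x" and WW: "W (W x) = W x" and BW: "B (W x) = 0" and WB: "W (B x) = 0"
    and k_pos: "k > 0" and c_pos: "c > 0"
    and scaleB: "F \<in> borel_measurable borel \<Longrightarrow> u > 0 \<Longrightarrow>
      (\<integral>\<^sup>+ x. F (x + (u - 1) *\<^sub>R B x) \<partial>lborel) = ennreal (u powr (- k)) * (\<integral>\<^sup>+ x. F x \<partial>lborel)"
    and scaleW: "F \<in> borel_measurable borel \<Longrightarrow> u > 0 \<Longrightarrow>
      (\<integral>\<^sup>+ x. F (x + (u - 1) *\<^sub>R W x) \<partial>lborel) = ennreal (u powr (- (c * k))) * (\<integral>\<^sup>+ x. F x \<partial>lborel)"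
    and AE_B: "AE x in lborel. B x \<noteq> 0" and AE_W: "AE x in lborel. W x \<noteq> 0"
begin

text \<open>The F density with \<open>k\<close> and \<open>c * k\<close> degrees of freedom,
  stripped of the factors independent of \<open>r\<close>.\<close>

definition fker :: "real \<Rightarrow> real" where
  "fker r = (if r > 0 then r powr (k / 2 - 1) * (1 + r / c) powr (- (k + c * k) / 2) else 0)"

text \<open>The curve X(r; a) with the directions and residual of \<open>x\<close>, but with
  \<open>(norm (W x))^2\<close> as its squared radius Delta. So for \<open>B x \<noteq> 0\<close>
  and \<open>r > 0\<close> the curve does not pass through \<open>x\<close>: the point is only a
  label, from which \<open>norm (B x)\<close> drops out.\<close>

definition fibre :: "real \<Rightarrow> 'a \<Rightarrow> 'a" where
  "fibre r x = (sqrt (r / (c + r)) * norm (W x) / norm (B x)) *\<^sub>R B x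
     + sqrt (c / (c + r)) *\<^sub>R W x + (x - B x - W x)"

text \<open>The two powers cancel those of \<open>norm (W x)\<close> and \<open>norm (B x)\<close>
  that arise when \<open>r\<close> is substituted. The indicator is the weight on the redundant
  radius, with a window of logarithmic length 1.\<close>

definition fibre_weight :: "'a \<Rightarrow> real" where
  "fibre_weight x = norm (W x) powr k * (indicator {1..exp 1} (norm (B x)) * norm (B x) powr (- k))"

lemma measB[measurable]: "B \<in> borel_measurable borel"
  by (rule linear_borel_measurable[OF linB])

lemma measW[measurable]: "W \<in> borel_measurable borel"
  by (rule linear_borel_measurable[OF linW])

lemma fker_measurable[measurable]: "fker \<in> borel_measurable borel"
  unfolding fker_def by measurable

lemma fker_nonneg: "fker r \<ge> 0"
  by (simp add: fker_def)

lemma fibre_measurable[measurable]: "(\<lambda>(r, x). fibre r x) \<in> borel_measurable (borel \<Otimes>\<^sub>M borel)"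
  unfolding fibre_def by measurable

lemma fibre_weight_measurable[measurable]: "fibre_weight \<in> borel_measurable borel"
  unfolding fibre_weight_def by measurable

lemma fibre_weight_nonneg: "fibre_weight x \<ge> 0"
  by (simp add: fibre_weight_def)

lemma B_scaleB: "B (x + u *\<^sub>R B x) = (1 + u) *\<^sub>R B x"
  by (simp add: linear_add[OF linB] linear_scale[OF linB] BB algebra_simps)

lemma B_scaleW: "B (x + u *\<^sub>R W x) = B x"
  by (simp add: linear_add[OF linB] linear_scale[OF linB] BW)

lemma W_scaleW: "W (x + u *\<^sub>R W x) = (1 + u) *\<^sub>R W x"
  by (simp add: linear_add[OF linW] linear_scale[OF linW] WW algebra_simps)

text \<open>Undoing the scaling inside \<open>\<Phi>\<close> costs the Jacobian
  \<open>exp (- k * \<theta>)\<close>, which the prefactor absorbs; \<open>\<theta>\<close> survives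
  only as a dilation of the window for \<open>norm (B x)\<close>.\<close>

lemma nn_integral_scaleB:
  assumes [measurable]: "\<Phi> \<in> borel_measurable borel"
  shows "(\<integral>\<^sup>+ x. ennreal (exp (k * \<theta>)) * indicator {1..exp 1} (norm (B x)) * \<Phi> (x + (exp \<theta> - 1) *\<^sub>R B x) \<partial>lborel)
       = (\<integral>\<^sup>+ x. indicator {1..exp 1} (exp (- \<theta>) * norm (B x)) * \<Phi> x \<partial>lborel)"
proof -
  define F where "F x = indicator {1..exp 1} (exp (- \<theta>) * norm (B x)) * \<Phi> x" for x
  have [measurable]: "F \<in> borel_measurable borel" unfolding F_def by measurable
  have "F (x + (exp \<theta> - 1) *\<^sub>R B x) = indicator {1..exp 1} (norm (B x)) * \<Phi> (x + (exp \<theta> - 1) *\<^sub>R B x)" for x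
  proof -
    have n: "exp (- \<theta>) * norm ((1 + (exp \<theta> - 1)) *\<^sub>R B x) = norm (B x)"
      by (simp add: exp_minus)
    show ?thesis unfolding F_def B_scaleB n ..
  qed
  then have "(\<integral>\<^sup>+ x. ennreal (exp (k * \<theta>)) * indicator {1..exp 1} (norm (B x)) * \<Phi> (x + (exp \<theta> - 1) *\<^sub>R B x) \<partial>lborel)
     = ennreal (exp (k * \<theta>)) * (\<integral>\<^sup>+ x. F (x + (exp \<theta> - 1) *\<^sub>R B x) \<partial>lborel)"
    by (simp add: nn_integral_cmult[symmetric] mult.assoc)
  also have "\<dots> = ennreal (exp (k * \<theta>)) * (ennreal (exp \<theta> powr (- k)) * (\<integral>\<^sup>+ x. F x \<partial>lborel))"
    by (subst scaleB) auto
  also have "\<dots> = (\<integral>\<^sup>+ x. F x \<partial>lborel)"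
    by (simp add: mult.assoc[symmetric] ennreal_mult[symmetric] powr_def exp_add[symmetric])
  finally show ?thesis by (simp add: F_def)
qed

text \<open>Dilating the range of \<open>W\<close> restores the coefficient of \<open>W x\<close> in
  the fibre to 1, so that the fibre point differs from \<open>x\<close> in the range of
  \<open>B\<close> only. The Jacobian and the homogeneity of \<open>fibre_weight\<close> together
  remove the factor \<open>(1 + r / c) powr (- (k + c * k) / 2)\<close> of the kernel.\<close>

lemma nn_integral_scaleW:
  assumes [measurable]: "\<Phi> \<in> borel_measurable borel" and r: "r > 0"
  shows "(\<integral>\<^sup>+ x. ennreal (fker r) * (ennreal (fibre_weight x) * \<Phi> (fibre r x)) \<partial>lborel)
    = (\<integral>\<^sup>+ x. ennreal (r powr (k / 2 - 1)) * (ennreal (fibre_weight x) *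
         \<Phi> (x + (sqrt (r / c) * norm (W x) / norm (B x) - 1) *\<^sub>R B x)) \<partial>lborel)"
proof -
  \<comment> \<open>The reciprocal of the coefficient \<open>sqrt (c / (c + r))\<close> of
    \<open>W x\<close> in the fibre.\<close>
  define a where "a = sqrt (1 + r / c)"
  have rc: "1 + r / c > 0" using r c_pos by (simp add: add_pos_pos)
  have a: "a > 0" using rc by (simp add: a_def)
  define G where "G x = ennreal (fibre_weight x) * \<Phi> (fibre r x)" for x
  have [measurable]: "G \<in> borel_measurable borel" unfolding G_def by measurable
  have sq1: "sqrt (r / (c + r)) * a = sqrt (r / c)" and sq2: "sqrt (c / (c + r)) * a = 1"
  proof -
    have "1 + r / c = (c + r) / c" "c + r \<noteq> 0" using r c_pos by (auto simp: field_simps)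
    then show "sqrt (r / (c + r)) * a = sqrt (r / c)" "sqrt (c / (c + r)) * a = 1"
      using r c_pos by (simp_all add: a_def real_sqrt_mult[symmetric])
  qed
  have fw: "fibre_weight (x + (a - 1) *\<^sub>R W x) = a powr k * fibre_weight x" for x
    using a by (simp add: fibre_weight_def B_scaleW W_scaleW powr_mult)
  have fb: "fibre r (x + (a - 1) *\<^sub>R W x) = x + (sqrt (r / c) * norm (W x) / norm (B x) - 1) *\<^sub>R B x" for x
  proof -
    have "fibre r (x + (a - 1) *\<^sub>R W x) = (sqrt (r / (c + r)) * a * norm (W x) / norm (B x)) *\<^sub>R B x
       + (sqrt (c / (c + r)) * a) *\<^sub>R W x + (x + (a - 1) *\<^sub>R W x - B x - a *\<^sub>R W x)"
      using a unfolding fibre_def B_scaleW W_scaleW by (simp add: mult_ac)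
    then show ?thesis unfolding sq1 sq2 by (simp add: algebra_simps)
  qed
  have G: "G (x + (a - 1) *\<^sub>R W x) = ennreal (a powr k) * (ennreal (fibre_weight x) *
      \<Phi> (x + (sqrt (r / c) * norm (W x) / norm (B x) - 1) *\<^sub>R B x))" for x
    unfolding G_def fw fb by (simp add: ennreal_mult fibre_weight_nonneg mult.assoc)
  have "ennreal (a powr (c * k)) * (\<integral>\<^sup>+ x. G (x + (a - 1) *\<^sub>R W x) \<partial>lborel)
      = ennreal (a powr (c * k)) * (ennreal (a powr (- (c * k))) * (\<integral>\<^sup>+ x. G x \<partial>lborel))"
    using a by (subst scaleW) auto
  also have "\<dots> = (\<integral>\<^sup>+ x. G x \<partial>lborel)"
    using a by (simp add: mult.assoc[symmetric] ennreal_mult[symmetric] powr_add[symmetric])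
  finally have "(\<integral>\<^sup>+ x. ennreal (fker r) * G x \<partial>lborel)
      = ennreal (fker r) * (ennreal (a powr (c * k)) * (\<integral>\<^sup>+ x. G (x + (a - 1) *\<^sub>R W x) \<partial>lborel))"
    by (simp add: nn_integral_cmult)
  also have "\<dots> = ennreal (fker r * a powr (c * k) * a powr k) *
      (\<integral>\<^sup>+ x. ennreal (fibre_weight x) *
      \<Phi> (x + (sqrt (r / c) * norm (W x) / norm (B x) - 1) *\<^sub>R B x) \<partial>lborel)"
    unfolding G by (subst nn_integral_cmult) (simp_all add: ennreal_mult fker_nonneg mult.assoc)
  also have "fker r * a powr (c * k) * a powr k = r powr (k / 2 - 1)"
  proof -
    have "a powr (c * k) * a powr k = (1 + r / c) powr ((k + c * k) / 2)"
      using rc by (simp add: a_def powr_half_sqrt[symmetric] powr_powr powr_add[symmetric] add_divide_distrib algebra_simps)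
    then have "fker r * (a powr (c * k) * a powr k) = r powr (k / 2 - 1) *
        ((1 + r / c) powr (- (k + c * k) / 2) * (1 + r / c) powr ((k + c * k) / 2))"
      using r by (simp add: fker_def)
    also have "(1 + r / c) powr (- (k + c * k) / 2) * (1 + r / c) powr ((k + c * k) / 2) = 1"
      using rc by (simp add: powr_add[symmetric] add_divide_distrib[symmetric])
    finally show ?thesis by (simp add: mult.assoc)
  qed
  finally show ?thesis by (simp add: G_def nn_integral_cmult)
qed

text \<open>At fixed \<open>x\<close> the coefficient of \<open>B x\<close> becomes
  \<open>exp \<theta>\<close>. The 2 is the derivative of the exponent
  \<open>t + 2 * \<theta>\<close>; the power \<open>r powr (k / 2)\<close> splits into
  \<open>c powr (k / 2)\<close>, \<open>exp (k * \<theta>)\<close> and a power of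
  \<open>norm (B x) / norm (W x)\<close> that \<open>fibre_weight\<close> cancels.\<close>

lemma nn_integral_radial_substitution:
  assumes [measurable]: "\<Phi> \<in> borel_measurable borel" and Bx: "B x \<noteq> 0" and Wx: "W x \<noteq> 0"
  shows "(\<integral>\<^sup>+ r. indicator {0<..} r * (ennreal (r powr (k / 2 - 1)) * (ennreal (fibre_weight x) *
         \<Phi> (x + (sqrt (r / c) * norm (W x) / norm (B x) - 1) *\<^sub>R B x))) \<partial>lborel)
    = (\<integral>\<^sup>+ \<theta>. ennreal (2 * c powr (k / 2)) * (ennreal (exp (k * \<theta>)) *
         indicator {1..exp 1} (norm (B x)) * \<Phi> (x + (exp \<theta> - 1) *\<^sub>R B x)) \<partial>lborel)"
proof -
  define b where "b = norm (B x)"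
  define w where "w = norm (W x)"
  have b: "b > 0" and w: "w > 0" using Bx Wx by (auto simp: b_def w_def)
  \<comment> \<open>Chosen so that \<open>r = exp (t + 2 * \<theta>)\<close> gives
    \<open>sqrt (r / c) * w / b = exp \<theta>\<close>.\<close>
  define t where "t = ln (c * (b / w)\<^sup>2)"
  have et: "exp t = c * (b / w)\<^sup>2" using b w c_pos by (simp add: t_def)
  have eth: "sqrt (exp (t + 2 * \<theta>) / c) * w / b = exp \<theta>" for \<theta>
  proof -
    have "exp (t + 2 * \<theta>) / c = ((b / w) * exp \<theta>)\<^sup>2"
      using c_pos by (simp add: exp_add et power_mult_distrib exp_double power_divide)
    then have "sqrt (exp (t + 2 * \<theta>) / c) = b / w * exp \<theta>"
      using b w by simp
    then show ?thesis using b w by simp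
  qed
  have wt: "exp (t + 2 * \<theta>) powr (k / 2 - 1) * (fibre_weight x * exp (t + 2 * \<theta>))
      = c powr (k / 2) * (exp (k * \<theta>) * indicator {1..exp 1} b)" for \<theta>
  proof -
    have "exp (t + 2 * \<theta>) powr (k / 2 - 1) * exp (t + 2 * \<theta>) = exp (t + 2 * \<theta>) powr (k / 2 - 1) * exp (t + 2 * \<theta>) powr 1"
      by simp
    also have "\<dots> = exp (t + 2 * \<theta>) powr (k / 2)"
      by (simp only: powr_add[symmetric]) simp
    also have "\<dots> = exp t powr (k / 2) * exp (k * \<theta>)"
      by (simp add: powr_def exp_add[symmetric] algebra_simps)
    also have "exp t powr (k / 2) = c powr (k / 2) * (b powr k * w powr (- k))"
    proof -
      have "exp t powr (k / 2) = c powr (k / 2) * ((b / w)\<^sup>2) powr (k / 2)"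
        unfolding et by (rule powr_mult)
      also have "((b / w)\<^sup>2) powr (k / 2) = ((b / w) powr 2) powr (k / 2)"
        using b w by (simp add: powr_numeral)
      also have "\<dots> = b powr k * w powr (- k)"
        using b w unfolding powr_powr by (simp add: powr_divide powr_minus_divide)
      finally show ?thesis .
    qed
    finally have e: "exp (t + 2 * \<theta>) powr (k / 2 - 1) * exp (t + 2 * \<theta>)
       = c powr (k / 2) * (b powr k * w powr (- k)) * exp (k * \<theta>)" .
    have "b powr k * w powr (- k) * fibre_weight x = indicator {1..exp 1} b * ((b powr k * b powr (- k)) * (w powr k * w powr (- k)))"
      by (simp add: fibre_weight_def b_def w_def)
    also have "\<dots> = indicator {1..exp 1} b"
      using b w by (simp add: powr_add[symmetric])
    finally have f: "b powr k * w powr (- k) * fibre_weight x = indicator {1..exp 1} b" .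
    have "exp (t + 2 * \<theta>) powr (k / 2 - 1) * (fibre_weight x * exp (t + 2 * \<theta>))
      = (exp (t + 2 * \<theta>) powr (k / 2 - 1) * exp (t + 2 * \<theta>)) * fibre_weight x" by simp
    also have "\<dots> = c powr (k / 2) * exp (k * \<theta>) * (b powr k * w powr (- k) * fibre_weight x)"
      unfolding e by simp
    finally show ?thesis unfolding f by simp
  qed
  define H where "H r = ennreal (r powr (k / 2 - 1)) * (ennreal (fibre_weight x) *
         \<Phi> (x + (sqrt (r / c) * w / b - 1) *\<^sub>R B x))" for r
  have [measurable]: "H \<in> borel_measurable borel" unfolding H_def by measurable
  have "(\<integral>\<^sup>+ r. indicator {0<..} r * H r \<partial>lborel) = (\<integral>\<^sup>+ s. H (exp s) * ennreal (exp s) \<partial>lborel)"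
    by (rule nn_integral_exp_substitution) measurable
  also have "\<dots> = ennreal \<bar>2\<bar> * (\<integral>\<^sup>+ \<theta>. H (exp (t + 2 * \<theta>)) * ennreal (exp (t + 2 * \<theta>)) \<partial>lborel)"
    by (rule nn_integral_real_affine) auto
  also have "\<dots> = (\<integral>\<^sup>+ \<theta>. ennreal 2 * (H (exp (t + 2 * \<theta>)) * ennreal (exp (t + 2 * \<theta>))) \<partial>lborel)"
    by (subst nn_integral_cmult) auto
  also have "\<dots> = (\<integral>\<^sup>+ \<theta>. ennreal (2 * c powr (k / 2)) * (ennreal (exp (k * \<theta>)) *
         indicator {1..exp 1} b * \<Phi> (x + (exp \<theta> - 1) *\<^sub>R B x)) \<partial>lborel)"
  proof (rule nn_integral_cong)
    fix \<theta>
    have "H (exp (t + 2 * \<theta>)) * ennreal (exp (t + 2 * \<theta>)) =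
       ennreal (exp (t + 2 * \<theta>) powr (k / 2 - 1) * (fibre_weight x * exp (t + 2 * \<theta>))) * \<Phi> (x + (exp \<theta> - 1) *\<^sub>R B x)"
      unfolding H_def eth by (simp add: ennreal_mult fibre_weight_nonneg mult_ac)
    also have "\<dots> = ennreal (c powr (k / 2)) * (ennreal (exp (k * \<theta>)) * indicator {1..exp 1} b)
        * \<Phi> (x + (exp \<theta> - 1) *\<^sub>R B x)"
      unfolding wt by (simp add: ennreal_mult ennreal_indicator)
    finally show "ennreal 2 * (H (exp (t + 2 * \<theta>)) * ennreal (exp (t + 2 * \<theta>))) =
        ennreal (2 * c powr (k / 2)) * (ennreal (exp (k * \<theta>)) *
         indicator {1..exp 1} b * \<Phi> (x + (exp \<theta> - 1) *\<^sub>R B x))"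
      by (simp add: ennreal_mult mult.assoc)
  qed
  finally show ?thesis by (simp add: H_def b_def w_def)
qed

text \<open>Each interchange of integrals prepares a substitution in the inner variable alone:
  scaling the range of \<open>W\<close> at fixed \<open>r\<close>, passing from \<open>r\<close> to
  \<open>\<theta>\<close> at fixed \<open>x\<close>, scaling the range of \<open>B\<close> at fixed
  \<open>\<theta>\<close>. After that \<open>\<theta>\<close> is left only in the window, and its
  integral is 1.\<close>

theorem nn_integral_fibre:
  assumes [measurable]: "\<Phi> \<in> borel_measurable borel"
  shows "(\<integral>\<^sup>+ x. \<integral>\<^sup>+ r. ennreal (fker r) * (ennreal (fibre_weight x) * \<Phi> (fibre r x)) \<partial>lborel \<partial>lborel)
    = ennreal (2 * c powr (k / 2)) * (\<integral>\<^sup>+ x. \<Phi> x \<partial>lborel)"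
proof -
  define K where "K = ennreal (2 * c powr (k / 2))"
  have "(\<integral>\<^sup>+ x. \<integral>\<^sup>+ r. ennreal (fker r) * (ennreal (fibre_weight x) * \<Phi> (fibre r x)) \<partial>lborel \<partial>lborel)
    = (\<integral>\<^sup>+ r. \<integral>\<^sup>+ x. ennreal (fker r) * (ennreal (fibre_weight x) * \<Phi> (fibre r x)) \<partial>lborel \<partial>lborel)"
    by (rule nn_integral_lborel_swap) (simp add: borel_prod[symmetric])
  also have "\<dots> = (\<integral>\<^sup>+ r. \<integral>\<^sup>+ x. indicator {0<..} r * (ennreal (r powr (k / 2 - 1)) * (ennreal (fibre_weight x) *
         \<Phi> (x + (sqrt (r / c) * norm (W x) / norm (B x) - 1) *\<^sub>R B x))) \<partial>lborel \<partial>lborel)"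
  proof (rule nn_integral_cong)
    fix r :: real
    show "(\<integral>\<^sup>+ x. ennreal (fker r) * (ennreal (fibre_weight x) * \<Phi> (fibre r x)) \<partial>lborel)
      = (\<integral>\<^sup>+ x. indicator {0<..} r * (ennreal (r powr (k / 2 - 1)) * (ennreal (fibre_weight x) *
         \<Phi> (x + (sqrt (r / c) * norm (W x) / norm (B x) - 1) *\<^sub>R B x))) \<partial>lborel)"
    proof (cases "r > 0")
      case True
      then show ?thesis using nn_integral_scaleW[of \<Phi> r] by simp
    qed (simp add: fker_def)
  qed
  also have "\<dots> = (\<integral>\<^sup>+ x. \<integral>\<^sup>+ r. indicator {0<..} r * (ennreal (r powr (k / 2 - 1)) * (ennreal (fibre_weight x) *
         \<Phi> (x + (sqrt (r / c) * norm (W x) / norm (B x) - 1) *\<^sub>R B x))) \<partial>lborel \<partial>lborel)"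
    by (rule nn_integral_lborel_swap) (simp add: borel_prod[symmetric])
  also have "\<dots> = (\<integral>\<^sup>+ x. \<integral>\<^sup>+ \<theta>. K * (ennreal (exp (k * \<theta>)) *
         indicator {1..exp 1} (norm (B x)) * \<Phi> (x + (exp \<theta> - 1) *\<^sub>R B x)) \<partial>lborel \<partial>lborel)"
    using AE_B AE_W
    by (intro nn_integral_cong_AE) (auto simp: K_def nn_integral_radial_substitution)
  also have "\<dots> = (\<integral>\<^sup>+ \<theta>. \<integral>\<^sup>+ x. K * (ennreal (exp (k * \<theta>)) *
         indicator {1..exp 1} (norm (B x)) * \<Phi> (x + (exp \<theta> - 1) *\<^sub>R B x)) \<partial>lborel \<partial>lborel)"
    by (rule nn_integral_lborel_swap) (simp add: borel_prod[symmetric])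
  also have "\<dots> = (\<integral>\<^sup>+ \<theta>. \<integral>\<^sup>+ x. K * (indicator {1..exp 1} (exp (- \<theta>) * norm (B x)) * \<Phi> x) \<partial>lborel \<partial>lborel)"
    by (rule nn_integral_cong) (simp add: nn_integral_cmult nn_integral_scaleB)
  also have "\<dots> = (\<integral>\<^sup>+ x. \<integral>\<^sup>+ \<theta>. K * (indicator {1..exp 1} (exp (- \<theta>) * norm (B x)) * \<Phi> x) \<partial>lborel \<partial>lborel)"
    by (rule nn_integral_lborel_swap) (simp add: borel_prod[symmetric])
  also have "\<dots> = (\<integral>\<^sup>+ x. K * \<Phi> x \<partial>lborel)"
  proof (rule nn_integral_cong_AE, use AE_B in eventually_elim)
    fix x assume "B x \<noteq> 0"
    then have b: "norm (B x) > 0" by simp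
    \<comment> \<open>With \<open>b = norm (B x)\<close>, the window condition says that
      \<open>\<theta>\<close> lies in \<open>[ln b - 1, ln b]\<close>, an interval of length
      one.\<close>
    have "exp (- \<theta>) * norm (B x) = exp (ln (norm (B x)) - \<theta>)" for \<theta>
      using b by (simp add: exp_diff exp_minus field_simps)
    then have "(indicator {1..exp 1} (exp (- \<theta>) * norm (B x)) :: ennreal)
        = indicator {ln (norm (B x)) - 1 .. ln (norm (B x))} \<theta>" for \<theta>
      by (auto simp: indicator_def)
    then show "(\<integral>\<^sup>+ \<theta>. K * (indicator {1..exp 1} (exp (- \<theta>) * norm (B x)) * \<Phi> x) \<partial>lborel) = K * \<Phi> x"
      by (simp add: nn_integral_cmult nn_integral_multc)
  qed
  finally show ?thesis by (simp add: K_def nn_integral_cmult)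
qed

end

section \<open>Conditional validity along the fibres\<close>

text \<open>A nonempty compact part of the rejection set has a least point \<open>r\<close>, which
  is itself rejected; the part lies to the right of \<open>r\<close>, where mass less than
  \<open>\<alpha> * T\<close> remains. Inner regularity passes the bound to the whole set, which
  avoids quantiles.\<close>

lemma nn_integral_tail_less_le:
  fixes q :: "real \<Rightarrow> real"
  assumes q0: "\<And>r. q r \<ge> 0" and qneg: "\<And>r. r < 0 \<Longrightarrow> q r = 0" and int: "integrable lborel q"
    and \<alpha>: "\<alpha> \<ge> 0"
  shows "(\<integral>\<^sup>+ r. indicator {r. 1 - (LINT s:{0..r}|lborel. q s) / (LINT s:{0..}|lborel. q s) < \<alpha>} r
      * ennreal (q r) \<partial>lborel) \<le> ennreal \<alpha> * (\<integral>\<^sup>+ r. ennreal (q r) \<partial>lborel)"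
proof -
  have [measurable]: "q \<in> borel_measurable borel" using int by auto
  define T where "T = (LINT s|lborel. q s)"
  have T0: "T \<ge> 0" unfolding T_def by (simp add: q0)
  have total: "(\<integral>\<^sup>+ r. ennreal (q r) \<partial>lborel) = ennreal T"
    unfolding T_def by (rule nn_integral_eq_integral[OF int]) (simp add: q0)
  have Tset: "(LINT s:{0..}|lborel. q s) = T"
    unfolding T_def set_lebesgue_integral_def
    by (intro Bochner_Integration.integral_cong) (auto simp: indicator_def not_le qneg)
  define E where "E = {r. 1 - (LINT s:{0..r}|lborel. q s) / T < \<alpha>}"
  have sint: "set_integrable lborel A q" if "A \<in> sets borel" for A
    unfolding set_integrable_def using that by (intro integrable_mult_indicator int) simp
  have mono: "(LINT s:{0..r}|lborel. q s) \<le> (LINT s:{0..r'}|lborel. q s)" if "r \<le> r'" for r r'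
    using that sint[of "{0..r}"] sint[of "{0..r'}"] unfolding set_integrable_def set_lebesgue_integral_def
    by (intro integral_mono) (auto simp: indicator_def q0)
  have [measurable]: "(\<lambda>r. LINT s:{0..r}|lborel. q s) \<in> borel_measurable borel"
    by (rule borel_measurable_mono) (auto simp: mono_def mono)
  have E[measurable]: "E \<in> sets borel" unfolding E_def by measurable
  show ?thesis
  proof (cases "T = 0")
    \<comment> \<open>With \<open>T = 0\<close> the quotient takes the default value 0, but the
      total mass is 0 as well, so both sides vanish.\<close>
    case True
    have "(\<integral>\<^sup>+ r. indicator E r * ennreal (q r) \<partial>lborel) \<le> (\<integral>\<^sup>+ r. ennreal (q r) \<partial>lborel)"
      by (intro nn_integral_mono) (auto simp: indicator_def)
    then show ?thesis unfolding Tset E_def[symmetric] by (simp add: total True)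
  next
    case False
    then have T: "T > 0" using T0 by simp
    define M where "M = density lborel (\<lambda>r. ennreal (q r))"
    have sM: "sets M = sets borel" by (simp add: M_def)
    have eM: "emeasure M A = (\<integral>\<^sup>+ r. indicator A r * ennreal (q r) \<partial>lborel)" if "A \<in> sets borel" for A
      using that by (simp add: M_def emeasure_density mult.commute)
    have fin: "emeasure M (space M) \<noteq> \<infinity>"
      by (simp add: M_def emeasure_density total)
    have "emeasure M E = (SUP K\<in>{K. K \<subseteq> E \<and> compact K}. emeasure M K)"
      by (rule inner_regular[OF sM fin E])
    also have "\<dots> \<le> ennreal (\<alpha> * T)"
    proof (rule SUP_least, clarify)
      fix K assume K: "K \<subseteq> E" "compact K"
      show "emeasure M K \<le> ennreal (\<alpha> * T)"
      proof (cases "K = {}")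
        case False
        then obtain r where r: "r \<in> K" "\<And>s. s \<in> K \<Longrightarrow> r \<le> s"
          using compact_attains_inf[OF K(2)] by blast
        then have "1 - (LINT s:{0..r}|lborel. q s) / T < \<alpha>" using K by (auto simp: E_def)
        then have rE: "T - (LINT s:{0..r}|lborel. q s) < \<alpha> * T" using T by (simp add: field_simps)
        have "emeasure M K \<le> emeasure M {r..}"
          using r sM by (intro emeasure_mono) auto
        \<comment> \<open>The ray and \<open>{0..r}\<close> both contain \<open>r\<close>; a single
          point is null.\<close>
        also have "\<dots> = (\<integral>\<^sup>+ s. ennreal (q s - indicator {0..r} s * q s) \<partial>lborel)"
        proof -
          have "AE s in lborel. s \<noteq> r" by (rule AE_lborel_singleton)
          then show ?thesis
            unfolding eM[of "{r..}", simplified]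
            by (intro nn_integral_cong_AE, eventually_elim) (auto simp: indicator_def not_le qneg)
        qed
        also have "\<dots> = ennreal (LINT s|lborel. q s - indicator {0..r} s * q s)"
          using int sint[of "{0..r}"]
          by (intro nn_integral_eq_integral) (auto simp: set_integrable_def indicator_def q0)
        also have "(LINT s|lborel. q s - indicator {0..r} s * q s) = T - (LINT s:{0..r}|lborel. q s)"
          using int sint[of "{0..r}"] by (simp add: T_def set_integrable_def set_lebesgue_integral_def)
        also have "ennreal \<dots> \<le> ennreal (\<alpha> * T)"
          using rE by (intro ennreal_leI) simp
        finally show ?thesis .
      qed simp
    qed
    also have "\<dots> = ennreal \<alpha> * ennreal T" using \<alpha> T0 by (rule ennreal_mult)
    finally show ?thesis unfolding Tset E_def[symmetric] total by (simp add: eM)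
  qed
qed

context projection_pair
begin

lemma fibre_weight_eq_0: "B x = 0 \<or> W x = 0 \<Longrightarrow> fibre_weight x = 0"
  by (auto simp: fibre_weight_def)

text \<open>\<open>L\<close> stands for the selection probability, \<open>g\<close> for the density
  of the data. The disintegration is applied to \<open>L * g\<close> with and without the indicator;
  since \<open>g\<close> is constant along fibres it leaves the integral over \<open>r\<close>, and
  the tail bound for \<open>C * fker r * L (fibre r x)\<close> finishes on each fibre.\<close>

lemma fibrewise_superuniform:
  fixes L g pv :: "'a \<Rightarrow> real" and \<alpha> C :: real
  assumes [measurable]: "L \<in> borel_measurable borel" "g \<in> borel_measurable borel" "pv \<in> borel_measurable borel"
    and L: "\<And>x. 0 \<le> L x" "\<And>x. L x \<le> 1" and g: "\<And>x. 0 \<le> g x"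
    and fin: "(\<integral>\<^sup>+ x. ennreal (g x) \<partial>lborel) < \<top>"
    and g_fibre: "\<And>r x. r > 0 \<Longrightarrow> B x \<noteq> 0 \<Longrightarrow> W x \<noteq> 0 \<Longrightarrow> g (fibre r x) = g (fibre 1 x)"
    and pv_fibre: "\<And>r x. r > 0 \<Longrightarrow> B x \<noteq> 0 \<Longrightarrow> W x \<noteq> 0 \<Longrightarrow> pv (fibre r x) =
      1 - (LINT s:{0..r}|lborel. C * fker s * L (fibre s x)) / (LINT s:{0..}|lborel. C * fker s * L (fibre s x))"
    and C: "C > 0" and \<alpha>: "\<alpha> \<ge> 0"
  shows "(\<integral>\<^sup>+ x. indicator {x. pv x < \<alpha>} x * ennreal (L x * g x) \<partial>lborel)
     \<le> ennreal \<alpha> * (\<integral>\<^sup>+ x. ennreal (L x * g x) \<partial>lborel)"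
\<comment> \<open>The case is split off because finiteness of the kernel integral is inferred below
  from a nonzero mass of \<open>g\<close>.\<close>
proof (cases "(\<integral>\<^sup>+ x. ennreal (g x) \<partial>lborel) = 0")
  case True
  have "(\<integral>\<^sup>+ x. indicator {x. pv x < \<alpha>} x * ennreal (L x * g x) \<partial>lborel) \<le> (\<integral>\<^sup>+ x. ennreal (g x) \<partial>lborel)"
    using L g by (intro nn_integral_mono) (auto simp: indicator_def mult_left_le_one_le intro!: ennreal_leI)
  with True show ?thesis by simp
next
  case False
  define K where "K = ennreal (2 * c powr (k / 2))"
  have K: "K \<noteq> 0" "K \<noteq> \<top>" using c_pos by (simp_all add: K_def ennreal_eq_0_iff not_le)
  note main = nn_integral_fibre[folded K_def]
  define h where "h x = ennreal (fibre_weight x * g (fibre 1 x))" for x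
  have [measurable]: "(\<lambda>x. fibre 1 x) \<in> borel_measurable borel"
    using measurable_Pair2[OF fibre_measurable, of 1] by simp
  have [measurable]: "h \<in> borel_measurable borel" unfolding h_def by measurable
  \<comment> \<open>For \<open>r \<le> 0\<close> the kernel is 0, and where \<open>B x\<close> or
    \<open>W x\<close> is 0 the weight is 0, so both sides vanish outside the range of
    \<open>g_fibre\<close>.\<close>
  have gh: "ennreal (fker r) * (ennreal (fibre_weight x) * (\<phi> (fibre r x) * ennreal (g (fibre r x))))
    = h x * (\<phi> (fibre r x) * ennreal (fker r))" for \<phi> :: "'a \<Rightarrow> ennreal" and r x
  proof (cases "r > 0 \<and> B x \<noteq> 0 \<and> W x \<noteq> 0")
    case True
    then show ?thesis
      using g_fibre[of r x] by (simp add: h_def ennreal_mult fibre_weight_nonneg g mult_ac)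
  next
    case False
    then show ?thesis by (auto simp: h_def fibre_weight_eq_0 fker_def)
  qed
  \<comment> \<open>No Beta integral is evaluated: the product of the integrals of \<open>h\<close>
    and of the kernel is \<open>K\<close> times the mass of \<open>g\<close>, and a finite nonzero
    product has finite factors.\<close>
  have fker_fin: "(\<integral>\<^sup>+ r. ennreal (fker r) \<partial>lborel) < \<top>"
  proof -
    have "(\<integral>\<^sup>+ x. h x \<partial>lborel) * (\<integral>\<^sup>+ r. ennreal (fker r) \<partial>lborel) =
        (\<integral>\<^sup>+ x. \<integral>\<^sup>+ r. h x * (1 * ennreal (fker r)) \<partial>lborel \<partial>lborel)"
      by (simp add: nn_integral_cmult nn_integral_multc)
    also have "\<dots> = K * (\<integral>\<^sup>+ x. ennreal (g x) \<partial>lborel)"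
      using main[of "\<lambda>x. ennreal (g x)"] gh[where \<phi>="\<lambda>_. 1"] by simp
    finally have eq: "(\<integral>\<^sup>+ x. h x \<partial>lborel) * (\<integral>\<^sup>+ r. ennreal (fker r) \<partial>lborel) = K * (\<integral>\<^sup>+ x. ennreal (g x) \<partial>lborel)" .
    have "K * (\<integral>\<^sup>+ x. ennreal (g x) \<partial>lborel) < \<top>" "K * (\<integral>\<^sup>+ x. ennreal (g x) \<partial>lborel) \<noteq> 0"
      using fin False K by (auto simp: ennreal_mult_less_top less_top)
    then show ?thesis unfolding eq[symmetric]
      by (auto simp: ennreal_mult_less_top)
  qed
  have int_fker: "integrable lborel fker"
    using fker_fin by (intro integrableI_nonneg) (auto simp: fker_nonneg)
  have inner: "(\<integral>\<^sup>+ r. indicator {x. pv x < \<alpha>} (fibre r x) * ennreal (L (fibre r x)) * ennreal (fker r) \<partial>lborel)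
      \<le> ennreal \<alpha> * (\<integral>\<^sup>+ r. ennreal (L (fibre r x)) * ennreal (fker r) \<partial>lborel)"
    if x: "B x \<noteq> 0" "W x \<noteq> 0" for x
  proof -
    have [measurable]: "(\<lambda>r. fibre r x) \<in> borel_measurable borel"
      using measurable_Pair1[OF fibre_measurable, of x] by simp
    define q where "q r = C * fker r * L (fibre r x)" for r
    have [measurable]: "q \<in> borel_measurable borel" unfolding q_def by measurable
    have q0: "q r \<ge> 0" for r using C L fker_nonneg by (simp add: q_def)
    have qneg: "q r = 0" if "r < 0" for r using that by (simp add: q_def fker_def)
    have "integrable lborel q"
    proof (rule Bochner_Integration.integrable_bound)
      show "integrable lborel (\<lambda>r. C * fker r)" using int_fker by simp
      show "AE r in lborel. norm (q r) \<le> norm (C * fker r)"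
        using C L fker_nonneg by (auto simp: q_def abs_mult intro!: mult_left_le)
    qed simp
    note tail = nn_integral_tail_less_le[OF q0 qneg this \<alpha>]
    have qe: "ennreal (q r) = ennreal C * (ennreal (L (fibre r x)) * ennreal (fker r))" for r
      using C L fker_nonneg by (simp add: q_def ennreal_mult mult_ac)
    have "ennreal C * (\<integral>\<^sup>+ r. indicator {x. pv x < \<alpha>} (fibre r x) * ennreal (L (fibre r x)) * ennreal (fker r) \<partial>lborel)
       = (\<integral>\<^sup>+ r. indicator {x. pv x < \<alpha>} (fibre r x) * ennreal (q r) \<partial>lborel)"
      by (subst nn_integral_cmult[symmetric]) (auto simp: qe mult_ac)
    also have "\<dots> = (\<integral>\<^sup>+ r. indicator {r. 1 - (LINT s:{0..r}|lborel. q s) / (LINT s:{0..}|lborel. q s) < \<alpha>} r * ennreal (q r) \<partial>lborel)"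
    proof (rule nn_integral_cong)
      fix r
      show "indicator {x. pv x < \<alpha>} (fibre r x) * ennreal (q r)
        = indicator {r. 1 - (LINT s:{0..r}|lborel. q s) / (LINT s:{0..}|lborel. q s) < \<alpha>} r * ennreal (q r)"
      proof (cases "r > 0")
        case True
        then show ?thesis using pv_fibre[OF _ x, of r] by (simp add: indicator_def q_def)
      qed (simp add: q_def fker_def)
    qed
    also have "\<dots> \<le> ennreal \<alpha> * (\<integral>\<^sup>+ r. ennreal (q r) \<partial>lborel)" by (rule tail)
    also have "\<dots> = ennreal C * (ennreal \<alpha> * (\<integral>\<^sup>+ r. ennreal (L (fibre r x)) * ennreal (fker r) \<partial>lborel))"
      unfolding qe by (subst nn_integral_cmult) (auto simp: mult_ac)
    finally show ?thesis using C
      by (simp add: ennreal_mult_le_mult_iff ennreal_eq_0_iff)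
  qed
  have "K * (\<integral>\<^sup>+ x. indicator {x. pv x < \<alpha>} x * ennreal (L x * g x) \<partial>lborel)
      = K * (\<integral>\<^sup>+ x. (indicator {x. pv x < \<alpha>} x * ennreal (L x)) * ennreal (g x) \<partial>lborel)"
    using L g by (simp add: ennreal_mult mult.assoc)
  also have "\<dots> = (\<integral>\<^sup>+ x. \<integral>\<^sup>+ r. h x * (indicator {x. pv x < \<alpha>} (fibre r x) * ennreal (L (fibre r x)) * ennreal (fker r)) \<partial>lborel \<partial>lborel)"
    unfolding gh[where \<phi> = "\<lambda>y. indicator {x. pv x < \<alpha>} y * ennreal (L y)", symmetric]
    by (rule main[of "\<lambda>x. (indicator {x. pv x < \<alpha>} x * ennreal (L x)) * ennreal (g x)", symmetric]) measurable
  also have "\<dots> \<le> (\<integral>\<^sup>+ x. ennreal \<alpha> * (\<integral>\<^sup>+ r. h x * (ennreal (L (fibre r x)) * ennreal (fker r)) \<partial>lborel) \<partial>lborel)"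
  proof (rule nn_integral_mono)
    fix x
    have [measurable]: "(\<lambda>r. fibre r x) \<in> borel_measurable borel"
      using measurable_Pair1[OF fibre_measurable, of x] by simp
    show "(\<integral>\<^sup>+ r. h x * (indicator {x. pv x < \<alpha>} (fibre r x) * ennreal (L (fibre r x)) * ennreal (fker r)) \<partial>lborel)
      \<le> ennreal \<alpha> * (\<integral>\<^sup>+ r. h x * (ennreal (L (fibre r x)) * ennreal (fker r)) \<partial>lborel)"
    proof (cases "B x \<noteq> 0 \<and> W x \<noteq> 0")
      case True
      then have "h x * (\<integral>\<^sup>+ r. indicator {x. pv x < \<alpha>} (fibre r x) * ennreal (L (fibre r x)) * ennreal (fker r) \<partial>lborel)
        \<le> h x * (ennreal \<alpha> * (\<integral>\<^sup>+ r. ennreal (L (fibre r x)) * ennreal (fker r) \<partial>lborel))"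
        by (intro mult_left_mono inner) auto
      then show ?thesis
        by (simp add: nn_integral_cmult mult.left_commute)
    next
      case False
      then show ?thesis by (auto simp: h_def fibre_weight_eq_0)
    qed
  qed
  also have "\<dots> = ennreal \<alpha> * (\<integral>\<^sup>+ x. \<integral>\<^sup>+ r. h x * (ennreal (L (fibre r x)) * ennreal (fker r)) \<partial>lborel \<partial>lborel)"
    by (rule nn_integral_cmult) measurable
  also have "(\<integral>\<^sup>+ x. \<integral>\<^sup>+ r. h x * (ennreal (L (fibre r x)) * ennreal (fker r)) \<partial>lborel \<partial>lborel)
     = K * (\<integral>\<^sup>+ x. ennreal (L x) * ennreal (g x) \<partial>lborel)"
    unfolding gh[where \<phi> = "\<lambda>y. ennreal (L y)", symmetric]
    by (rule main[of "\<lambda>x. ennreal (L x) * ennreal (g x)"]) measurable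
  also have "ennreal \<alpha> * \<dots> = K * (ennreal \<alpha> * (\<integral>\<^sup>+ x. ennreal (L x * g x) \<partial>lborel))"
    using L g by (simp add: ennreal_mult mult.left_commute)
  finally show ?thesis
    using K by (simp add: ennreal_mult_le_mult_iff)
qed

end

section \<open>The projections of a pair of clusters\<close>

lemma prod_Basis_rows:
  fixes f :: "real^'p^'n \<Rightarrow> 'c::comm_monoid_mult"
  shows "(\<Prod>b\<in>Basis. f b) = (\<Prod>i\<in>UNIV. \<Prod>j\<in>UNIV. f (axis i (axis j 1)))"
proof -
  have B: "(Basis :: (real^'p^'n) set) = (\<lambda>(i, j). axis i (axis j 1)) ` (UNIV \<times> UNIV)"
    by (auto simp: Basis_vec_def image_iff)
  have "inj (\<lambda>(i, j). axis i (axis j 1) :: real^'p^'n)"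
    by (auto simp: inj_on_def axis_eq_axis)
  then show ?thesis unfolding B
    by (subst prod.reindex) (simp_all add: prod.cartesian_product case_prod_unfold)
qed

text \<open>The map is diagonal in the standard basis; every scaled row contributes one factor
  \<open>u\<close> per entry.\<close>

lemma nn_integral_scale_rows:
  fixes F :: "real^'p^'n \<Rightarrow> ennreal"
  assumes [measurable]: "F \<in> borel_measurable borel" and u: "u > 0"
  shows "(\<integral>\<^sup>+ x. F (\<chi> i. if i \<in> J then u *\<^sub>R (x $ i) else x $ i) \<partial>lborel)
    = ennreal (u powr (- (real (card J) * real CARD('p)))) * (\<integral>\<^sup>+ x. F x \<partial>lborel)"
proof -
  define c :: "real^'p^'n \<Rightarrow> real" where "c b = (if \<exists>i\<in>J. b $ i \<noteq> 0 then u else 1)" for b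
  define T :: "real^'p^'n \<Rightarrow> real^'p^'n" where "T x = 0 + (\<Sum>b\<in>Basis. (c b * (x \<bullet> b)) *\<^sub>R b)" for x
  have c: "c b \<noteq> 0" for b using u by (simp add: c_def)
  have cax: "c (axis i (axis j 1)) = (if i \<in> J then u else 1)" for i j
    by (auto simp: c_def axis_def vec_eq_iff)
  have T: "T x = (\<chi> i. if i \<in> J then u *\<^sub>R (x $ i) else x $ i)" for x
  proof (rule euclidean_eqI)
    fix b :: "real^'p^'n" assume b: "b \<in> Basis"
    then obtain i j where ij: "b = axis i (axis j 1)" by (auto simp: Basis_vec_def)
    have "T x \<bullet> b = c b * (x \<bullet> b)" using b by (simp add: T_def inner_sum_left inner_Basis if_distrib cong: if_cong)
    also have "\<dots> = (\<chi> i. if i \<in> J then u *\<^sub>R (x $ i) else x $ i) \<bullet> b"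
      unfolding ij cax by (simp add: inner_axis)
    finally show "T x \<bullet> b = (\<chi> i. if i \<in> J then u *\<^sub>R (x $ i) else x $ i) \<bullet> b" .
  qed
  have prod: "(\<Prod>b\<in>Basis. \<bar>c b\<bar>) = u powr (real (card J) * real CARD('p))"
  proof -
    have "(\<Prod>b\<in>Basis. \<bar>c b\<bar>) = (\<Prod>i\<in>(UNIV::'n set). if i \<in> J then u ^ CARD('p) else 1)"
      unfolding prod_Basis_rows cax using u by (intro prod.cong) auto
    also have "\<dots> = u ^ (card J * CARD('p))"
      by (simp add: prod.If_cases power_mult[symmetric] mult.commute)
    finally show ?thesis using u by (simp add: powr_realpow[symmetric])
  qed
  have [measurable]: "T \<in> borel_measurable borel" unfolding T_def by measurable
  have "(\<integral>\<^sup>+ x. F x \<partial>lborel) = (\<integral>\<^sup>+ x. F x \<partial>density (distr lborel borel T) (\<lambda>_. (\<Prod>b\<in>Basis. \<bar>c b\<bar>)))"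
    unfolding T_def using lborel_affine_euclidean[of c 0] c by simp
  also have "\<dots> = ennreal (u powr (real (card J) * real CARD('p))) * (\<integral>\<^sup>+ x. F (T x) \<partial>lborel)"
    unfolding prod
    by (subst nn_integral_density, simp, simp) (simp add: nn_integral_distr nn_integral_cmult)
  finally have "ennreal (u powr (- (real (card J) * real CARD('p)))) * (\<integral>\<^sup>+ x. F x \<partial>lborel)
      = ennreal (u powr (- (real (card J) * real CARD('p))) * u powr (real (card J) * real CARD('p))) * (\<integral>\<^sup>+ x. F (T x) \<partial>lborel)"
    by (simp add: ennreal_mult mult.assoc)
  then show ?thesis using u by (simp add: T powr_add[symmetric])
qed

lemma linear_matrix_mult: "linear (\<lambda>x :: real^'p^'n. A ** x)"
  by (intro linearI) (simp_all add: vec_eq_iff matrix_matrix_mult_def sum.distrib sum_distrib_left algebra_simps)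

lemma matrix_mult_row: "(A ** (x :: real^'p^'n)) $ i = (\<Sum>k\<in>UNIV. A $ i $ k *\<^sub>R x $ k)"
  by (simp add: vec_eq_iff matrix_matrix_mult_def)

lemma symmetric_matrix_inner:
  fixes x y :: "real^'p^'n"
  assumes "\<And>i k. A $ i $ k = A $ k $ i"
  shows "(A ** x) \<bullet> y = x \<bullet> (A ** y)"
proof -
  have "(A ** x) \<bullet> y = (\<Sum>i\<in>UNIV. \<Sum>k\<in>UNIV. A $ i $ k * (x $ k \<bullet> y $ i))"
    unfolding inner_vec_def[of "A ** x"] matrix_mult_row by (simp add: inner_sum_left)
  also have "\<dots> = (\<Sum>k\<in>UNIV. \<Sum>i\<in>UNIV. A $ k $ i * (x $ k \<bullet> y $ i))"
    by (subst sum.swap) (simp add: assms)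
  also have "\<dots> = x \<bullet> (A ** y)"
    unfolding inner_vec_def[of x] matrix_mult_row by (simp add: inner_sum_right)
  finally show ?thesis .
qed

text \<open>For symmetric \<open>A\<close> the kernel is orthogonal to the range, so it lies in the
  hyperplane orthogonal to the nonzero \<open>A ** y\<close>.\<close>

lemma AE_symmetric_matrix_nonzero:
  fixes y :: "real^'p^'n"
  assumes sym: "\<And>i k. A $ i $ k = A $ k $ i" and y: "A ** y \<noteq> 0"
  shows "AE x::real^'p^'n in lborel. A ** x \<noteq> 0"
proof -
  have "negligible {x. (A ** y) \<bullet> x = 0}" by (rule negligible_hyperplane) (simp add: y)
  then have "AE x in lebesgue. x \<notin> {x. (A ** y) \<bullet> x = 0}"
    unfolding negligible_iff_null_sets by (rule AE_not_in)
  then have "AE x in lborel. x \<notin> {x. (A ** y) \<bullet> x = 0}"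
    by (simp add: AE_completion_iff)
  then show ?thesis
  proof eventually_elim
    case (elim x)
    have "(A ** y) \<bullet> x = y \<bullet> (A ** x)" by (rule symmetric_matrix_inner[OF sym])
    with elim show ?case by auto
  qed
qed

lemma center_row: "(center C ** (x :: real^'p^'n)) $ i
   = (if i \<in> C then x $ i - (1 / real (card C)) *\<^sub>R (\<Sum>k\<in>C. x $ k) else 0)"
proof (cases "i \<in> C")
  case True
  have "(center C ** x) $ i = (\<Sum>k\<in>UNIV. (if k = i then x $ k else 0) - (if k \<in> C then (1 / real (card C)) *\<^sub>R x $ k else 0))"
    unfolding matrix_mult_row center_def using True by (intro sum.cong) (auto simp: scaleR_diff_left)
  also have "\<dots> = x $ i - (1 / real (card C)) *\<^sub>R (\<Sum>k\<in>C. x $ k)"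
    by (simp add: sum_subtractf sum.If_cases scaleR_sum_right)
  finally show ?thesis using True by simp
next
  case False
  then show ?thesis by (simp add: matrix_mult_row center_def)
qed

lemma sum_center: "(\<Sum>k\<in>C. (center C ** (x :: real^'p^'n)) $ k) = 0"
proof -
  have "(\<Sum>k\<in>C. (center C ** x) $ k) = (\<Sum>k\<in>C. x $ k - (1 / real (card C)) *\<^sub>R (\<Sum>k\<in>C. x $ k))"
    by (intro sum.cong) (auto simp: center_row)
  also have "\<dots> = (\<Sum>k\<in>C. x $ k) - real (card C) *\<^sub>R (1 / real (card C)) *\<^sub>R (\<Sum>k\<in>C. x $ k)"
    by (simp only: sum_subtractf sum_constant_scaleR)
  also have "\<dots> = 0" by (cases "C = {}") auto
  finally show ?thesis .
qed

lemma center_eq_0: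
  fixes x :: "real^'p^'n"
  assumes "\<And>k. k \<in> C \<Longrightarrow> x $ k = v"
  shows "center C ** x = 0"
proof -
  have "(\<Sum>k\<in>C. x $ k) = real (card C) *\<^sub>R v"
    using assms by (simp only: sum_constant_scaleR[symmetric] cong: sum.cong)
  then show ?thesis using assms by (auto simp: vec_eq_iff center_row)
qed

lemma center_idem: "center C ** (center C ** x) = center C ** (x :: real^'p^'n)"
  by (simp add: vec_eq_iff center_row[of C "center C ** x"] sum_center) (simp add: center_row)

lemma center_disjoint: "C1 \<inter> C2 = {} \<Longrightarrow> center C1 ** (center C2 ** (x :: real^'p^'n)) = 0"
  by (rule center_eq_0[where v = 0]) (auto simp: center_row)

text \<open>The scaling becomes diagonal once one row of \<open>C\<close> is exchanged for the mean
  over \<open>C\<close> and the other rows of \<open>C\<close> for their deviations from it: the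
  mean is fixed and \<open>card C - 1\<close> deviations are multiplied by \<open>u\<close>.\<close>

lemma nn_integral_scale_center:
  fixes F :: "real^'p^'n \<Rightarrow> ennreal"
  assumes F: "F \<in> borel_measurable borel" and u: "u > 0" and C: "C \<noteq> {}"
  shows "(\<integral>\<^sup>+ x. F (x + (u - 1) *\<^sub>R (center C ** x)) \<partial>lborel)
    = ennreal (u powr (- ((real (card C) - 1) * real CARD('p)))) * (\<integral>\<^sup>+ x. F x \<partial>lborel)"
proof -
  obtain i0 where i0: "i0 \<in> C" using C by auto
  have cC: "card C \<ge> 1" using C by (simp add: Suc_le_eq card_gt_0_iff)
  define mean where "mean x = (1 / real (card C)) *\<^sub>R (\<Sum>k\<in>C. x $ k)" for x :: "real^'p^'n"
  define T :: "real^'p^'n \<Rightarrow> real^'p^'n" where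
    "T x = (\<chi> i. if i = i0 then mean x else if i \<in> C then x $ i - mean x else x $ i)" for x
  define D :: "real^'p^'n \<Rightarrow> real^'p^'n" where
    "D x = (\<chi> i. if i \<in> C - {i0} then u *\<^sub>R (x $ i) else x $ i)" for x
  have mean_add: "mean (x + y) = mean x + mean y" and mean_scale: "mean (r *\<^sub>R x) = r *\<^sub>R mean x" for x y r
    by (simp_all add: mean_def sum.distrib scaleR_sum_right algebra_simps)
  have linT: "linear T"
    by (intro linearI) (auto simp: T_def vec_eq_iff mean_add mean_scale algebra_simps)
  have linD: "linear D"
    by (intro linearI) (auto simp: D_def vec_eq_iff algebra_simps)
  have injT: "inj T"
  proof (rule linear_injective_0[THEN iffD2, OF linT], intro allI impI)
    fix x assume "T x = 0"
    then have Tx: "T x $ i = 0" for i by simp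
    have m: "mean x = 0" using Tx[of i0] by (simp add: T_def)
    have z: "x $ i = 0" if "i \<noteq> i0" for i using Tx[of i] that m by (simp add: T_def split: if_splits)
    have "(\<Sum>k\<in>C. x $ k) = x $ i0"
      using i0 z by (subst sum.remove[of C i0]) (auto intro!: sum.neutral)
    then have "x $ i0 = 0" using m C by (simp add: mean_def)
    with z show "x = 0" by (metis vec_eq_iff zero_index)
  qed
  have mean_center: "mean (center C ** x) = 0" for x
    by (simp add: mean_def sum_center)
  have TS: "T (x + (u - 1) *\<^sub>R (center C ** x)) = D (T x)" for x
  proof (rule iffD2[OF vec_eq_iff], rule allI)
    fix i
    have c: "(center C ** x) $ i = (if i \<in> C then x $ i - mean x else 0)"
      by (simp add: center_row mean_def)
    have "mean (x + (u - 1) *\<^sub>R (center C ** x)) = mean x"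
      by (simp add: mean_add mean_scale mean_center)
    then show "T (x + (u - 1) *\<^sub>R (center C ** x)) $ i = D (T x) $ i"
      using i0 by (simp add: T_def D_def c scaleR_diff_left scaleR_diff_right)
  qed
  have "card (C - {i0}) = card C - 1" using i0 by simp
  then have D: "(\<integral>\<^sup>+ x. F (D x) \<partial>lborel) = ennreal (u powr (- ((real (card C) - 1) * real CARD('p)))) * (\<integral>\<^sup>+ x. F x \<partial>lborel)"
    if "F \<in> borel_measurable borel" for F
    using nn_integral_scale_rows[OF that u, of "C - {i0}"] cC by (simp add: D_def of_nat_diff)
  show ?thesis
  proof (rule nn_integral_conjugate[of T D "\<lambda>x. x + (u - 1) *\<^sub>R (center C ** x)" "ennreal (u powr (- ((real (card C) - 1) * real CARD('p))))" F, OF linT injT linD _ _ F])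
    show "T (x + (u - 1) *\<^sub>R (center C ** x)) = D (T x)" for x by (fact TS)
    show "(\<integral>\<^sup>+ x. F (D x) \<partial>lborel) = ennreal (u powr (- ((real (card C) - 1) * real CARD('p)))) * (\<integral>\<^sup>+ x. F x \<partial>lborel)"
      if "F \<in> borel_measurable borel" for F by (fact D[OF that])
  qed
qed

text \<open>A tested merge has both sizes above \<open>nmin \<ge> 1\<close>. Sizes of at least 2
  make \<open>N - 2\<close> positive and \<open>W\<close> nonzero.\<close>

locale cluster_pair =
  fixes C1 C2 :: "'n::finite set"
  assumes disj: "C1 \<inter> C2 = {}" and card1: "card C1 \<ge> 2" and card2: "card C2 \<ge> 2"
begin

lemma ne: "C1 \<noteq> {}" "C2 \<noteq> {}"
  using card1 card2 by auto

lemma nu_nonzero: "nuvec C1 C2 \<noteq> 0"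
proof -
  obtain i where i: "i \<in> C1" using ne by auto
  with disj have "i \<notin> C2" by auto
  with i have "nuvec C1 C2 $ i = 1 / real (card C1)" by (simp add: nuvec_def)
  with card1 show ?thesis by (metis divide_eq_0_iff le_zero_eq of_nat_eq_0_iff one_neq_zero zero_index zero_neq_numeral)
qed

lemma norm_nu: "(norm (nuvec C1 C2))\<^sup>2 = (\<Sum>k\<in>UNIV. nuvec C1 C2 $ k * nuvec C1 C2 $ k)"
  by (simp add: power2_norm_eq_inner inner_vec_def)

lemma norm_nu_pos: "(norm (nuvec C1 C2))\<^sup>2 > 0"
  using nu_nonzero by simp

text \<open>The difference of the two cluster means, through which alone
  \<open>Bmat C1 C2 ** x\<close> depends on \<open>x\<close>.\<close>

definition contrast :: "real^'p^'n \<Rightarrow> real^'p" where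
  "contrast x = (\<Sum>k\<in>UNIV. nuvec C1 C2 $ k *\<^sub>R x $ k)"

lemma contrast_add: "contrast (x + y) = contrast x + contrast y"
  and contrast_scale: "contrast (r *\<^sub>R x) = r *\<^sub>R contrast x"
  by (simp_all add: contrast_def sum.distrib scaleR_sum_right algebra_simps)

lemma Bmat_row: "(Bmat C1 C2 ** (x :: real^'p^'n)) $ i = (nuvec C1 C2 $ i / (norm (nuvec C1 C2))\<^sup>2) *\<^sub>R contrast x"
  by (simp add: matrix_mult_row Bmat_def contrast_def scaleR_sum_right)

lemma contrast_B: "contrast (Bmat C1 C2 ** x) = contrast (x :: real^'p^'n)"
proof -
  have "contrast (Bmat C1 C2 ** x) = (\<Sum>k\<in>UNIV. (nuvec C1 C2 $ k * nuvec C1 C2 $ k / (norm (nuvec C1 C2))\<^sup>2) *\<^sub>R contrast x)"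
    unfolding contrast_def[of "Bmat C1 C2 ** x"] by (simp add: Bmat_row)
  also have "\<dots> = ((\<Sum>k\<in>UNIV. nuvec C1 C2 $ k * nuvec C1 C2 $ k) / (norm (nuvec C1 C2))\<^sup>2) *\<^sub>R contrast x"
    by (simp add: scaleR_sum_left sum_divide_distrib)
  finally show ?thesis using norm_nu_pos by (simp add: norm_nu[symmetric])
qed

lemma contrast_eq: "contrast (x :: real^'p^'n) = (1 / real (card C1)) *\<^sub>R (\<Sum>k\<in>C1. x $ k) - (1 / real (card C2)) *\<^sub>R (\<Sum>k\<in>C2. x $ k)"
proof -
  have "contrast x = (\<Sum>k\<in>UNIV. (if k \<in> C1 then (1 / real (card C1)) *\<^sub>R x $ k else 0) - (if k \<in> C2 then (1 / real (card C2)) *\<^sub>R x $ k else 0))"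
    unfolding contrast_def nuvec_def by (intro sum.cong) (auto simp: scaleR_diff_left)
  then show ?thesis by (simp add: sum_subtractf sum.If_cases scaleR_sum_right)
qed

lemma W_eq: "Wmat C1 C2 ** (x :: real^'p^'n) = center C1 ** x + center C2 ** x"
  by (simp add: Wmat_def vec_eq_iff matrix_mult_row sum.distrib scaleR_left_distrib)

lemma contrast_W: "contrast (Wmat C1 C2 ** (x :: real^'p^'n)) = 0"
proof -
  have "(\<Sum>k\<in>C1. (center C2 ** x) $ k) = 0" "(\<Sum>k\<in>C2. (center C1 ** x) $ k) = 0"
    using disj by (auto simp: center_row intro!: sum.neutral)
  then show ?thesis by (simp add: W_eq contrast_eq sum.distrib sum_center)
qed

lemma BB: "Bmat C1 C2 ** (Bmat C1 C2 ** x) = Bmat C1 C2 ** (x :: real^'p^'n)"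
  by (simp add: vec_eq_iff Bmat_row[of "Bmat C1 C2 ** x"] contrast_B) (simp add: Bmat_row)

lemma BW: "Bmat C1 C2 ** (Wmat C1 C2 ** (x :: real^'p^'n)) = 0"
  by (simp add: vec_eq_iff Bmat_row contrast_W)

lemma WW: "Wmat C1 C2 ** (Wmat C1 C2 ** x) = Wmat C1 C2 ** (x :: real^'p^'n)"
proof -
  have "C2 \<inter> C1 = {}" using disj by auto
  then show ?thesis
    by (simp add: W_eq matrix_add_ldistrib center_idem center_disjoint disj)
qed

text \<open>The entries of \<open>nuvec\<close> are constant on each cluster, hence so are the rows
  of \<open>Bmat C1 C2 ** x\<close>, and centring removes constants.\<close>

lemma WB: "Wmat C1 C2 ** (Bmat C1 C2 ** (x :: real^'p^'n)) = 0"
proof -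
  have "center C1 ** (Bmat C1 C2 ** x) = 0"
    by (rule center_eq_0[where v = "(1 / real (card C1) / (norm (nuvec C1 C2))\<^sup>2) *\<^sub>R contrast x"])
       (use disj in \<open>auto simp: Bmat_row nuvec_def\<close>)
  moreover have "center C2 ** (Bmat C1 C2 ** x) = 0"
    by (rule center_eq_0[where v = "(- 1 / real (card C2) / (norm (nuvec C1 C2))\<^sup>2) *\<^sub>R contrast x"])
       (use disj in \<open>auto simp: Bmat_row nuvec_def\<close>)
  ultimately show ?thesis by (simp add: W_eq)
qed

lemma B_sym: "Bmat C1 C2 $ i $ k = Bmat C1 C2 $ k $ i"
  by (simp add: Bmat_def)

lemma W_sym: "Wmat C1 C2 $ i $ k = Wmat C1 C2 $ k $ i"
  by (auto simp: Wmat_def center_def)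

text \<open>Centrings of disjoint clusters annihilate each other, so scaling the range of
  \<open>W\<close> is the composition of the scalings for the two clusters;
  \<open>card C1 - 1\<close> and \<open>card C2 - 1\<close> add up to \<open>N - 2\<close>.\<close>

lemma scaleW:
  fixes F :: "real^'p^'n \<Rightarrow> ennreal"
  assumes F[measurable]: "F \<in> borel_measurable borel" and u: "u > 0"
  shows "(\<integral>\<^sup>+ x. F (x + (u - 1) *\<^sub>R (Wmat C1 C2 ** x)) \<partial>lborel)
    = ennreal (u powr (- ((real (card C1 + card C2) - 2) * real CARD('p)))) * (\<integral>\<^sup>+ x. F x \<partial>lborel)"
proof -
  define G where "G x = F (x + (u - 1) *\<^sub>R (center C1 ** x))" for x
  have [measurable]: "(\<lambda>x :: real^'p^'n. center C1 ** x) \<in> borel_measurable borel"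
    by (intro linear_borel_measurable linear_matrix_mult)
  have G[measurable]: "G \<in> borel_measurable borel" unfolding G_def by measurable
  have FG: "F (x + (u - 1) *\<^sub>R (Wmat C1 C2 ** x)) = G (x + (u - 1) *\<^sub>R (center C2 ** x))" for x
    unfolding G_def W_eq linear_add[OF linear_matrix_mult] linear_scale[OF linear_matrix_mult] center_disjoint[OF disj]
    by (simp add: scaleR_add_right add_ac)
  have "(\<integral>\<^sup>+ x. F (x + (u - 1) *\<^sub>R (Wmat C1 C2 ** x)) \<partial>lborel)
     = ennreal (u powr (- ((real (card C2) - 1) * real CARD('p)))) * (\<integral>\<^sup>+ x. G x \<partial>lborel)"
    unfolding FG by (rule nn_integral_scale_center[OF G u ne(2)])
  also have "(\<integral>\<^sup>+ x. G x \<partial>lborel) = ennreal (u powr (- ((real (card C1) - 1) * real CARD('p)))) * (\<integral>\<^sup>+ x. F x \<partial>lborel)"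
    unfolding G_def by (rule nn_integral_scale_center[OF F u ne(1)])
  also have "ennreal (u powr (- ((real (card C2) - 1) * real CARD('p)))) * \<dots>
      = ennreal (u powr (- ((real (card C1 + card C2) - 2) * real CARD('p)))) * (\<integral>\<^sup>+ x. F x \<partial>lborel)"
  proof -
    have "u powr (- ((real (card C2) - 1) * real CARD('p))) * u powr (- ((real (card C1) - 1) * real CARD('p)))
      = u powr (- ((real (card C1 + card C2) - 2) * real CARD('p)))"
      unfolding powr_add[symmetric] by (simp add: algebra_simps)
    then show ?thesis by (simp only: mult.assoc[symmetric] ennreal_mult[symmetric] powr_ge_zero)
  qed
  finally show ?thesis .
qed

text \<open>A row \<open>i0\<close> at which \<open>nuvec\<close> is nonzero is exchanged for the
  contrast, every other row for its residual after \<open>B\<close>. In these coordinates the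
  scaling multiplies the single row \<open>i0\<close>.\<close>

lemma scaleB:
  fixes F :: "real^'p^'n \<Rightarrow> ennreal"
  assumes F: "F \<in> borel_measurable borel" and u: "u > 0"
  shows "(\<integral>\<^sup>+ x. F (x + (u - 1) *\<^sub>R (Bmat C1 C2 ** x)) \<partial>lborel)
    = ennreal (u powr (- real CARD('p))) * (\<integral>\<^sup>+ x. F x \<partial>lborel)"
proof -
  obtain i0 where i0: "nuvec C1 C2 $ i0 \<noteq> 0" using nu_nonzero by (metis vec_eq_iff zero_index)
  define T :: "real^'p^'n \<Rightarrow> real^'p^'n" where
    "T x = (\<chi> i. if i = i0 then contrast x else x $ i - (Bmat C1 C2 ** x) $ i)" for x
  define D :: "real^'p^'n \<Rightarrow> real^'p^'n" where
    "D x = (\<chi> i. if i \<in> {i0} then u *\<^sub>R (x $ i) else x $ i)" for x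
  have linT: "linear T"
    by (intro linearI) (auto simp: T_def vec_eq_iff contrast_add contrast_scale
        linear_add[OF linear_matrix_mult] linear_scale[OF linear_matrix_mult] algebra_simps)
  have linD: "linear D"
    by (intro linearI) (auto simp: D_def vec_eq_iff algebra_simps)
  have injT: "inj T"
  proof (rule linear_injective_0[THEN iffD2, OF linT], intro allI impI)
    fix x assume "T x = 0"
    then have Tx: "T x $ i = 0" for i by simp
    have c: "contrast x = 0" using Tx[of i0] by (simp add: T_def)
    have z: "x $ i = 0" if "i \<noteq> i0" for i using Tx[of i] that c by (simp add: T_def Bmat_row)
    have "contrast x = nuvec C1 C2 $ i0 *\<^sub>R x $ i0"
      unfolding contrast_def using z by (subst sum.remove[of _ i0]) (auto intro!: sum.neutral)
    then have "x $ i0 = 0" using c i0 by simp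
    with z show "x = 0" by (metis vec_eq_iff zero_index)
  qed
  have TS: "T (x + (u - 1) *\<^sub>R (Bmat C1 C2 ** x)) = D (T x)" for x
    unfolding T_def D_def contrast_add contrast_scale contrast_B
      linear_add[OF linear_matrix_mult] linear_scale[OF linear_matrix_mult] BB
    by (auto simp: vec_eq_iff algebra_simps)
  have D: "(\<integral>\<^sup>+ x. F (D x) \<partial>lborel) = ennreal (u powr (- real CARD('p))) * (\<integral>\<^sup>+ x. F x \<partial>lborel)"
    if "F \<in> borel_measurable borel" for F
    using nn_integral_scale_rows[OF that u, of "{i0}"] by (simp add: D_def)
  show ?thesis
  proof (rule nn_integral_conjugate[of T D "\<lambda>x. x + (u - 1) *\<^sub>R (Bmat C1 C2 ** x)" "ennreal (u powr (- real CARD('p)))" F, OF linT injT linD _ _ F])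
    show "T (x + (u - 1) *\<^sub>R (Bmat C1 C2 ** x)) = D (T x)" for x by (fact TS)
    show "(\<integral>\<^sup>+ x. F (D x) \<partial>lborel) = ennreal (u powr (- real CARD('p))) * (\<integral>\<^sup>+ x. F x \<partial>lborel)"
      if "F \<in> borel_measurable borel" for F by (fact D[OF that])
  qed
qed

lemma AE_B: "AE x::real^'p^'n in lborel. Bmat C1 C2 ** x \<noteq> 0"
proof (rule AE_symmetric_matrix_nonzero[OF B_sym])
  \<comment> \<open>This matrix lies in the range of \<open>B\<close>; its contrast is a positive
    multiple of the all-ones vector.\<close>
  define y :: "real^'p^'n" where "y = (\<chi> i. nuvec C1 C2 $ i *\<^sub>R (\<chi> j. 1))"
  have "contrast y = (norm (nuvec C1 C2))\<^sup>2 *\<^sub>R (\<chi> j. 1)"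
    by (simp add: contrast_def y_def norm_nu scaleR_sum_left)
  then have "contrast y \<noteq> 0" using norm_nu_pos by (simp add: vec_eq_iff)
  moreover obtain i where "nuvec C1 C2 $ i \<noteq> 0" using nu_nonzero by (metis vec_eq_iff zero_index)
  ultimately have "(Bmat C1 C2 ** y) $ i \<noteq> 0" using norm_nu_pos by (simp add: Bmat_row)
  then show "Bmat C1 C2 ** y \<noteq> 0" by auto
qed

lemma AE_W: "AE x::real^'p^'n in lborel. Wmat C1 C2 ** x \<noteq> 0"
proof -
  obtain i where i: "i \<in> C1" using ne by auto
  \<comment> \<open>A single nonzero row inside \<open>C1\<close>: centring leaves the factor
    \<open>1 - 1 / card C1\<close>, nonzero because \<open>card C1 \<ge> 2\<close>.\<close>
  define y :: "real^'p^'n" where "y = (\<chi> k. if k = i then (\<chi> j. 1) else 0)"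
  have "(\<Sum>k\<in>C1. y $ k) = (\<chi> j. 1)" using i by (simp add: y_def)
  then have "(Wmat C1 C2 ** y) $ i = (1 - 1 / real (card C1)) *\<^sub>R (\<chi> j. 1)"
    using i disj by (auto simp: W_eq center_row y_def scaleR_diff_left)
  moreover have "1 - 1 / real (card C1) \<noteq> 0" using card1 by (simp add: field_simps)
  moreover have "(\<chi> j. 1 :: real^'p) \<noteq> 0" by (simp add: vec_eq_iff)
  ultimately have "(Wmat C1 C2 ** y) $ i \<noteq> 0" by (simp add: vec_eq_iff)
  then have "Wmat C1 C2 ** y \<noteq> 0" by auto
  then show ?thesis by (rule AE_symmetric_matrix_nonzero[OF W_sym])
qed

lemma projection_pair:
  "projection_pair (\<lambda>x :: real^'p^'n. Bmat C1 C2 ** x) (\<lambda>x. Wmat C1 C2 ** x) (real CARD('p)) (real (card C1 + card C2) - 2)"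
proof (rule projection_pair.intro)
  show "real (card C1 + card C2) - 2 > 0" "real CARD('p) > 0" using card1 card2 by simp_all
  show "AE x::real^'p^'n in lborel. Bmat C1 C2 ** x \<noteq> 0" by (rule AE_B)
  show "AE x::real^'p^'n in lborel. Wmat C1 C2 ** x \<noteq> 0" by (rule AE_W)
  fix F :: "real^'p^'n \<Rightarrow> ennreal" and u :: real
  assume Fu: "F \<in> borel_measurable borel" "u > 0"
  show "(\<integral>\<^sup>+ x. F (x + (u - 1) *\<^sub>R (Bmat C1 C2 ** x)) \<partial>lborel)
    = ennreal (u powr (- real CARD('p))) * (\<integral>\<^sup>+ x. F x \<partial>lborel)"
    by (rule scaleB[OF Fu])
  show "(\<integral>\<^sup>+ x. F (x + (u - 1) *\<^sub>R (Wmat C1 C2 ** x)) \<partial>lborel)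
    = ennreal (u powr (- ((real (card C1 + card C2) - 2) * real CARD('p)))) * (\<integral>\<^sup>+ x. F x \<partial>lborel)"
    by (rule scaleW[OF Fu])
next
  fix x :: "real^'p^'n"
  show "Bmat C1 C2 ** (Bmat C1 C2 ** x) = Bmat C1 C2 ** x" by (rule BB)
  show "Wmat C1 C2 ** (Wmat C1 C2 ** x) = Wmat C1 C2 ** x" by (rule WW)
  show "Bmat C1 C2 ** (Wmat C1 C2 ** x) = 0" by (rule BW)
  show "Wmat C1 C2 ** (Bmat C1 C2 ** x) = 0" by (rule WB)
qed (rule linear_matrix_mult)+

end

section \<open>The p-value under the null hypothesis\<close>

context projection_pair
begin

lemma B_fibre: "B (fibre r x) = (sqrt (r / (c + r)) * norm (W x) / norm (B x)) *\<^sub>R B x"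
  by (simp add: fibre_def linear_add[OF linB] linear_diff[OF linB] linear_scale[OF linB] BB BW)

lemma W_fibre: "W (fibre r x) = sqrt (c / (c + r)) *\<^sub>R W x"
  by (simp add: fibre_def linear_add[OF linW] linear_diff[OF linW] linear_scale[OF linW] WW WB)

lemma rest_fibre: "fibre r x - B (fibre r x) - W (fibre r x) = x - B x - W x"
  unfolding B_fibre W_fibre by (simp add: fibre_def)

lemma norm_B_fibre: "r > 0 \<Longrightarrow> B x \<noteq> 0 \<Longrightarrow> norm (B (fibre r x)) = sqrt (r / (c + r)) * norm (W x)"
  using c_pos by (simp add: B_fibre)

lemma norm_W_fibre: "r > 0 \<Longrightarrow> norm (W (fibre r x)) = sqrt (c / (c + r)) * norm (W x)"
  using c_pos by (simp add: W_fibre)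

lemma norm_sum_fibre:
  assumes "r > 0" "B x \<noteq> 0"
  shows "(norm (B (fibre r x)))\<^sup>2 + (norm (W (fibre r x)))\<^sup>2 = (norm (W x))\<^sup>2"
proof -
  have "r / (c + r) + c / (c + r) = 1" using assms c_pos by (simp add: add_divide_distrib[symmetric])
  moreover have "r / (c + r) \<ge> 0" "c / (c + r) \<ge> 0" using assms c_pos by auto
  ultimately have "(norm (B (fibre r x)))\<^sup>2 + (norm (W (fibre r x)))\<^sup>2
      = r / (c + r) * (norm (W x))\<^sup>2 + c / (c + r) * (norm (W x))\<^sup>2"
    unfolding norm_B_fibre[OF assms] norm_W_fibre[OF assms(1)] power_mult_distrib
    by (simp only: real_sqrt_pow2)
  also have "\<dots> = (r / (c + r) + c / (c + r)) * (norm (W x))\<^sup>2" by (rule distrib_right[symmetric])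
  finally show ?thesis using \<open>r / (c + r) + c / (c + r) = 1\<close> by simp
qed

text \<open>Together with the invariance of the directions, the squared radius and the residual,
  this says that along one fibre the conditioning data stay fixed and the observed statistic R is
  the parameter \<open>r\<close>.\<close>

lemma statistic_fibre:
  assumes "r > 0" "B x \<noteq> 0" "W x \<noteq> 0"
  shows "c * (norm (B (fibre r x)))\<^sup>2 / (norm (W (fibre r x)))\<^sup>2 = r"
  using assms c_pos by (simp add: norm_B_fibre norm_W_fibre power_mult_distrib)

lemma direction_B_fibre:
  assumes "r > 0" "B x \<noteq> 0" "W x \<noteq> 0"
  shows "B (fibre r x) /\<^sub>R norm (B (fibre r x)) = B x /\<^sub>R norm (B x)"
  unfolding norm_B_fibre[OF assms(1,2)] using assms c_pos by (simp add: B_fibre field_simps)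

lemma direction_W_fibre:
  assumes "r > 0" "W x \<noteq> 0"
  shows "W (fibre r x) /\<^sub>R norm (W (fibre r x)) = W x /\<^sub>R norm (W x)"
  unfolding norm_W_fibre[OF assms(1)] using assms c_pos by (simp add: W_fibre field_simps)

lemma F_density_eq_fker:
  "F_density k (c * k) r = ((1 / c) powr (k / 2) / Beta (k / 2) (c * k / 2)) * fker r"
proof -
  have "k / (c * k) = 1 / c" "k * r / (c * k) = r / c" using k_pos by auto
  then show ?thesis unfolding F_density_def fker_def by auto
qed

lemma F_density_const_pos: "(1 / c) powr (k / 2) / Beta (k / 2) (c * k / 2) > 0"
  unfolding Beta_def using c_pos k_pos
  by (intro divide_pos_pos mult_pos_pos Gamma_real_pos) (auto simp: add_pos_pos)

text \<open>If \<open>B\<close> and \<open>W\<close> annihilate the mean, the Gaussian density is a function of \<open>\<parallel>B x\<parallel>\<^sup>2 + \<parallel>W x\<parallel>\<^sup>2\<close>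
  and the residual, hence constant along the fibres.\<close>

lemma norm_fibre_minus:
  assumes symB: "\<And>x y. B x \<bullet> y = x \<bullet> B y" and symW: "\<And>x y. W x \<bullet> y = x \<bullet> W y"
    and mu: "B \<mu> = 0" "W \<mu> = 0" and r: "r > 0" "B x \<noteq> 0"
  shows "(norm (fibre r x - \<mu>))\<^sup>2 = (norm (W x))\<^sup>2 + (norm (x - B x - W x - \<mu>))\<^sup>2"
proof -
  define y where "y = fibre r x"
  define z where "z = y - B y - W y - \<mu>"
  have Bz: "B z = 0" and Wz: "W z = 0"
    by (simp_all add: z_def linear_diff[OF linB] linear_diff[OF linW] BB BW WB WW mu)
  have "y - \<mu> = B y + W y + z" by (simp add: z_def)
  moreover have "B y \<bullet> W y = 0" "B y \<bullet> z = 0" "W y \<bullet> z = 0"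
    by (simp_all add: symB symW BW Bz Wz)
  ultimately have "(norm (y - \<mu>))\<^sup>2 = (norm (B y))\<^sup>2 + (norm (W y))\<^sup>2 + (norm z)\<^sup>2"
    by (simp add: power2_norm_eq_inner inner_add inner_commute)
  also have "z = x - B x - W x - \<mu>" unfolding z_def y_def rest_fibre ..
  finally show ?thesis unfolding y_def norm_sum_fibre[OF r] .
qed

end

section \<open>The Gaussian density of the data matrix\<close>

definition gauss_density :: "real^'p^'n \<Rightarrow> real \<Rightarrow> real^'p^'n \<Rightarrow> real" where
  "gauss_density mu sig x = (\<Prod>i\<in>UNIV. \<Prod>j\<in>UNIV. normal_density (mu $ i $ j) sig (x $ i $ j))"

lemma gauss_density_nonneg: "gauss_density mu sig x \<ge> 0"
  by (simp add: gauss_density_def prod_nonneg)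

lemma gauss_density_measurable[measurable]: "gauss_density (mu :: real^'p^'n) sig \<in> borel_measurable borel"
proof -
  have [measurable]: "(\<lambda>x :: real^'p^'n. x $ i $ j) \<in> borel_measurable borel" for i j
    by (intro borel_measurable_continuous_onI continuous_intros)
  show ?thesis unfolding gauss_density_def by measurable
qed

lemma gauss_density_eq:
  fixes mu :: "real^'p^'n"
  obtains K where "\<And>x. gauss_density mu sig x = K * exp (- (norm (x - mu))\<^sup>2 / (2 * sig\<^sup>2))"
proof
  fix x
  have "(norm (x - mu))\<^sup>2 = (\<Sum>i\<in>UNIV. \<Sum>j\<in>UNIV. (x $ i $ j - mu $ i $ j)\<^sup>2)"
    unfolding power2_norm_eq_inner inner_vec_def by (simp add: power2_eq_square)
  then have e: "exp (- (norm (x - mu))\<^sup>2 / (2 * sig\<^sup>2))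
      = (\<Prod>i\<in>UNIV. \<Prod>j\<in>UNIV. exp (- (x $ i $ j - mu $ i $ j)\<^sup>2 / (2 * sig\<^sup>2)))"
    by (simp add: exp_sum[symmetric] sum_divide_distrib sum_negf)
  show "gauss_density mu sig x = (\<Prod>i\<in>(UNIV::'n set). \<Prod>j\<in>(UNIV::'p set). 1 / sqrt (2 * pi * sig\<^sup>2))
      * exp (- (norm (x - mu))\<^sup>2 / (2 * sig\<^sup>2))"
    unfolding e gauss_density_def normal_density_def by (simp only: prod.distrib)
qed

lemma nn_integral_gauss_density:
  fixes mu :: "real^'p^'n"
  assumes "sig > 0"
  shows "(\<integral>\<^sup>+ x. ennreal (gauss_density mu sig x) \<partial>lborel) = 1"
proof -
  have "ennreal (gauss_density mu sig x) = (\<Prod>b\<in>Basis. ennreal (normal_density (mu \<bullet> b) sig (x \<bullet> b)))" for x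
    unfolding prod_Basis_rows gauss_density_def
    by (simp add: prod_ennreal prod_nonneg inner_axis)
  then have "(\<integral>\<^sup>+ x. ennreal (gauss_density mu sig x) \<partial>lborel)
      = (\<Prod>b\<in>(Basis :: (real^'p^'n) set). \<integral>\<^sup>+ y. ennreal (normal_density (mu \<bullet> b) sig y) \<partial>lborel)"
    by (simp only:) (rule nn_integral_lborel_prod, auto)
  also have "\<dots> = 1"
    using assms integral_normal_density[OF assms] integrable_normal_density[OF assms]
    by (simp add: nn_integral_eq_integral)
  finally show ?thesis .
qed

lemma gauss_data_eq: "gauss_data mu sig = density lborel (\<lambda>x. ennreal (gauss_density mu sig x))"
  by (simp add: gauss_data_def gauss_density_def)

section \<open>Measurability and bounds for merge probabilities and p-values\<close>

lemma temp_measurable: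
  assumes [measurable]: "\<And>M. d M \<in> borel_measurable borel"
  shows "temp d tau P \<in> borel_measurable borel"
  unfolding temp_def by measurable

lemma merge_prob_measurable:
  assumes [measurable]: "\<And>M. d M \<in> borel_measurable borel"
  shows "merge_prob d tau P M \<in> borel_measurable borel"
proof -
  have [measurable]: "temp d tau P \<in> borel_measurable borel" by (rule temp_measurable) fact
  show ?thesis unfolding merge_prob_def by measurable
qed

lemma seq_lik_measurable:
  assumes "\<And>M. d M \<in> borel_measurable borel"
  shows "seq_lik d tau m t \<in> borel_measurable borel"
proof -
  have [measurable]: "merge_prob d tau P M \<in> borel_measurable borel" for P M
    by (rule merge_prob_measurable) fact
  show ?thesis unfolding seq_lik_def by measurable
qed

lemma merge_prob_nonneg: "merge_prob d tau P M x \<ge> 0"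
  by (simp add: merge_prob_def sum_nonneg)

text \<open>An inequality because \<open>cands P\<close> may be empty: then both sums are 0, and
  otherwise the quotient is 1.\<close>

lemma merge_prob_sum_le_1:
  fixes P :: "'n::finite set set"
  shows "(\<Sum>M\<in>cands P. merge_prob d tau P M x) \<le> 1"
proof -
  have "(\<Sum>M\<in>cands P. merge_prob d tau P M x)
     = (\<Sum>M\<in>cands P. exp (- d M x / temp d tau P x)) / (\<Sum>M\<in>cands P. exp (- d M x / temp d tau P x))"
    by (simp add: merge_prob_def sum_divide_distrib[symmetric])
  then show ?thesis by simp
qed

lemma merge_prob_le_1:
  fixes P :: "'n::finite set set"
  shows "merge_prob d tau P M x \<le> 1"
proof (cases "M \<in> cands P")
  case True
  have "merge_prob d tau P M x \<le> (\<Sum>M\<in>cands P. merge_prob d tau P M x)"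
    using True by (intro member_le_sum) (auto simp: merge_prob_nonneg)
  then show ?thesis using merge_prob_sum_le_1[of d tau P x] by linarith
qed (simp add: merge_prob_def)

lemma seq_lik_nonneg: "seq_lik d tau m t x \<ge> 0"
  by (simp add: seq_lik_def prod_nonneg merge_prob_nonneg)

lemma seq_lik_le_1: "seq_lik d tau m t (x :: real^'p^'n) \<le> 1"
  unfolding seq_lik_def by (intro prod_le_1) (simp add: merge_prob_nonneg merge_prob_le_1)

lemma F_density_measurable[measurable]: "F_density a b \<in> borel_measurable borel"
  unfolding F_density_def by measurable

lemma matrix_mult_measurable[measurable]: "(\<lambda>x :: real^'p^'n. A ** x) \<in> borel_measurable borel"
  by (intro linear_borel_measurable linear_matrix_mult)

lemma pvalue_measurable:
  fixes d :: "'n::finite set set \<Rightarrow> real^'p^'n \<Rightarrow> real"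
  assumes "\<And>M. d M \<in> borel_measurable borel"
  shows "pvalue d tau m t \<in> borel_measurable borel"
proof -
  have [measurable]: "seq_lik d tau m t \<in> borel_measurable borel"
    by (rule seq_lik_measurable) fact
  \<comment> \<open>The upper limit moves with \<open>x\<close>; writing the indicator of
    \<open>{0..u x}\<close> as a comparison makes the integrand jointly measurable.\<close>
  have [measurable]: "(\<lambda>x. LINT s:{0..u x}|lborel. q x s) \<in> borel_measurable borel"
    if [measurable]: "(\<lambda>(x, s). q x s) \<in> borel_measurable (borel \<Otimes>\<^sub>M borel)" "u \<in> borel_measurable borel"
    for q :: "real^'p^'n \<Rightarrow> real \<Rightarrow> real" and u
    unfolding set_lebesgue_integral_def
  proof (rule lborel.borel_measurable_lebesgue_integral)
    have "(\<lambda>(x, s). (if 0 \<le> s \<and> s \<le> u x then 1 else 0) *\<^sub>R q x s) \<in> borel_measurable (borel \<Otimes>\<^sub>M borel)"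
      by measurable
    then show "(\<lambda>(x, s). indicat_real {0..u x} s *\<^sub>R q x s) \<in> borel_measurable (borel \<Otimes>\<^sub>M lborel)"
      by (simp add: indicator_def case_prod_unfold cong: measurable_cong_sets)
  qed
  have [measurable]: "(\<lambda>x. LINT s:{0..}|lborel. q x s) \<in> borel_measurable borel"
    if [measurable]: "(\<lambda>(x, s). q x s) \<in> borel_measurable (borel \<Otimes>\<^sub>M borel)"
    for q :: "real^'p^'n \<Rightarrow> real \<Rightarrow> real"
    unfolding set_lebesgue_integral_def
    by (rule lborel.borel_measurable_lebesgue_integral) measurable
  show ?thesis
    unfolding pvalue_def Fcdf_def Let_def Xr_def prod.case by measurable
qed

context cluster_pair
begin

text \<open>A mean with equal rows on \<open>C1 \<union> C2\<close> has zero contrast and zero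
  deviations, so \<open>B\<close> and \<open>W\<close> annihilate it and the Gaussian density is
  constant along the fibres. The selection probability is \<open>seq_lik d tau m t\<close>.\<close>

lemma pvalue_superuniform:
  fixes mu :: "real^'p^'n" and d :: "'n set set \<Rightarrow> real^'p^'n \<Rightarrow> real"
  assumes sig: "sig > 0" and d: "\<And>M. d M \<in> borel_measurable borel"
    and cl: "cl1 (m ! (t - 1)) = C1" "cl2 (m ! (t - 1)) = C2"
    and mu: "\<And>i. i \<in> C1 \<union> C2 \<Longrightarrow> mu $ i = v" and \<alpha>: "\<alpha> \<ge> 0"
  shows "(\<integral>\<^sup>+ x. indicator {x. pvalue d tau m t x < \<alpha>} x * ennreal (seq_lik d tau m t x * gauss_density mu sig x) \<partial>lborel)
     \<le> ennreal \<alpha> * (\<integral>\<^sup>+ x. ennreal (seq_lik d tau m t x * gauss_density mu sig x) \<partial>lborel)"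
proof -
  interpret projection_pair "\<lambda>x :: real^'p^'n. Bmat C1 C2 ** x" "\<lambda>x. Wmat C1 C2 ** x"
    "real CARD('p)" "real (card C1 + card C2) - 2"
    by (rule projection_pair)
  define C where "C = (1 / (real (card C1 + card C2) - 2)) powr (real CARD('p) / 2)
      / Beta (real CARD('p) / 2) ((real (card C1 + card C2) - 2) * real CARD('p) / 2)"
  have W0: "Wmat C1 C2 ** mu = 0"
    using center_eq_0[of C1 mu v] center_eq_0[of C2 mu v] mu by (simp add: W_eq)
  have "(1 / real (card C1)) *\<^sub>R (\<Sum>k\<in>C1. mu $ k) = v" "(1 / real (card C2)) *\<^sub>R (\<Sum>k\<in>C2. mu $ k) = v"
    using mu ne by (simp_all add: sum_constant_scaleR del: sum_constant)
  then have B0: "Bmat C1 C2 ** mu = 0"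
    by (simp add: vec_eq_iff Bmat_row contrast_eq)
  show ?thesis
  proof (rule fibrewise_superuniform[where C = C])
    show "C > 0" unfolding C_def by (rule F_density_const_pos)
    show "seq_lik d tau m t \<in> borel_measurable borel" by (rule seq_lik_measurable) (rule d)
    show "pvalue d tau m t \<in> borel_measurable borel" by (rule pvalue_measurable) (rule d)
    show "(\<integral>\<^sup>+ x. ennreal (gauss_density mu sig x) \<partial>lborel) < \<top>"
      by (simp add: nn_integral_gauss_density[OF sig])
    fix r :: real and x :: "real^'p^'n"
    assume r: "r > 0" and b: "Bmat C1 C2 ** x \<noteq> 0" and w: "Wmat C1 C2 ** x \<noteq> 0"
    note symB = symmetric_matrix_inner[of "Bmat C1 C2", OF B_sym]
    note symW = symmetric_matrix_inner[of "Wmat C1 C2", OF W_sym]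
    obtain K where K: "\<And>x. gauss_density mu sig x = K * exp (- (norm (x - mu))\<^sup>2 / (2 * sig\<^sup>2))"
      using gauss_density_eq by blast
    have "(norm (fibre r x - mu))\<^sup>2 = (norm (fibre 1 x - mu))\<^sup>2"
      using norm_fibre_minus[OF symB symW B0 W0 r b] norm_fibre_minus[OF symB symW B0 W0 _ b, of 1] by simp
    then show "gauss_density mu sig (fibre r x) = gauss_density mu sig (fibre 1 x)"
      by (simp add: K)
    define N where "N = card C1 + card C2"
    \<comment> \<open>The conditioning data common to all points of the fibre labelled by
      \<open>x\<close>; the third entry is the squared radius of that fibre.\<close>
    define a where "a = ((Bmat C1 C2 ** x) /\<^sub>R norm (Bmat C1 C2 ** x), (Wmat C1 C2 ** x) /\<^sub>R norm (Wmat C1 C2 ** x),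
        (norm (Wmat C1 C2 ** x))\<^sup>2, x - Bmat C1 C2 ** x - Wmat C1 C2 ** x)"
    have X: "Xr N a s = fibre s x" for s
      unfolding Xr_def a_def fibre_def N_def prod.case
      using w by (simp add: scaleR_add_right divide_inverse mult_ac)
    have "pvalue d tau m t (fibre r x) = 1 - Fcdf d tau m t N a r"
      unfolding pvalue_def Let_def cl direction_B_fibre[OF r b w] direction_W_fibre[OF r w]
        norm_sum_fibre[OF r b] rest_fibre statistic_fibre[OF r b w]
      by (simp only: a_def N_def)
    then show "pvalue d tau m t (fibre r x) =
      1 - (LINT s:{0..r}|lborel. C * fker s * seq_lik d tau m t (fibre s x)) /
          (LINT s:{0..}|lborel. C * fker s * seq_lik d tau m t (fibre s x))"
      by (simp only: Fcdf_def Let_def X[unfolded N_def] N_def F_density_eq_fker C_def)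
  qed (simp_all add: seq_lik_nonneg seq_lik_le_1 gauss_density_nonneg \<alpha>)
qed

end

section \<open>Alpha spending along the merge tree\<close>

definition valid_prefix :: "'n set set list \<Rightarrow> bool" where
  "valid_prefix m \<longleftrightarrow> (\<forall>s < length m. m ! s \<in> cands (parts m s))"

text \<open>The descendants of the node \<open>ms\<close>, \<open>k\<close> levels further down;
  with \<open>k\<close> the number of remaining merges they are the complete runs that begin with
  \<open>ms\<close>.\<close>

fun extensions :: "nat \<Rightarrow> 'n set set list \<Rightarrow> 'n set set list set" where
  "extensions 0 ms = {ms}"
| "extensions (Suc k) ms = (\<Union>M\<in>cands (parts ms (length ms)). extensions k (ms @ [M]))"

lemma parts_cong: "take s m = take s m' \<Longrightarrow> s \<le> length m \<Longrightarrow> s \<le> length m' \<Longrightarrow> parts m s = parts m' s"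
proof (induction s)
  case (Suc s)
  have "m ! s = m' ! s" using arg_cong[OF Suc.prems(1), of "\<lambda>l. l ! s"] by simp
  moreover have "take s m = take s m'"
    using arg_cong[OF Suc.prems(1), of "take s"] by (simp add: min_def)
  ultimately show ?case using Suc by simp
qed simp

lemma parts_append: "s \<le> length ms \<Longrightarrow> parts (ms @ xs) s = parts ms s"
  by (rule parts_cong) auto

lemma valid_prefix_snoc:
  "valid_prefix ms \<Longrightarrow> M \<in> cands (parts ms (length ms)) \<Longrightarrow> valid_prefix (ms @ [M])"
  by (auto simp: valid_prefix_def parts_append nth_append less_Suc_eq)

text \<open>The union of two blocks meets no surviving block, so merging preserves disjointness.
  This supplies \<open>disj\<close> for the tested pair.\<close>

lemma valid_prefix_disjoint:
  "valid_prefix m \<Longrightarrow> s \<le> length m \<Longrightarrow> A \<in> parts m s \<Longrightarrow> B \<in> parts m s \<Longrightarrow> A \<noteq> B \<Longrightarrow> A \<inter> B = {}"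
proof (induction s arbitrary: A B)
  case 0
  then show ?case by (auto simp: singletons_def)
next
  case (Suc s)
  have "m ! s \<in> cands (parts m s)" using Suc.prems(1,2) by (simp add: valid_prefix_def)
  then have M: "m ! s \<subseteq> parts m s" by (auto simp: cands_def)
  have IH: "A \<inter> B = {}" if "A \<in> parts m s" "B \<in> parts m s" "A \<noteq> B" for A B
    by (rule Suc.IH[OF Suc.prems(1) _ that]) (use Suc.prems(2) in simp)
  have U: "A \<inter> \<Union>(m ! s) = {}" if "A \<in> parts m s - m ! s" for A
  proof (intro equals0I)
    fix x assume "x \<in> A \<inter> \<Union>(m ! s)"
    then obtain B where B: "B \<in> m ! s" "x \<in> A \<inter> B" by auto
    with that M have "A \<inter> B = {}" by (intro IH) auto
    with B show False by auto
  qed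
  have AB: "A \<in> parts m s - m ! s \<or> A = \<Union>(m ! s)" "B \<in> parts m s - m ! s \<or> B = \<Union>(m ! s)"
    using Suc.prems(3,4) by (simp_all add: merge_part_def disj_commute)
  then consider "A \<in> parts m s - m ! s" "B \<in> parts m s - m ! s"
    | "A \<in> parts m s - m ! s" "B = \<Union>(m ! s)" | "A = \<Union>(m ! s)" "B \<in> parts m s - m ! s"
    using Suc.prems(5) by (elim disjE) simp_all
  then show ?case
  proof cases
    case 1
    then show ?thesis using Suc.prems(5) by (intro IH) auto
  next
    case 2
    then show ?thesis using U by simp
  next
    case 3
    then show ?thesis using U[of B] by (simp add: Int_commute)
  qed
qed

text \<open>The two \<open>SOME\<close> choices recover both members of the pair, in an unspecified
  order.\<close>

lemma cl_cands:
  assumes "M \<in> cands P"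
  shows "cl1 M \<in> P" "cl2 M \<in> P" "cl1 M \<noteq> cl2 M" "M = {cl1 M, cl2 M}"
proof -
  obtain A B where AB: "M = {A, B}" "A \<in> P" "B \<in> P" "A \<noteq> B" using assms by (auto simp: cands_def)
  have c1: "cl1 M \<in> M" unfolding cl1_def by (rule someI[of _ A]) (simp add: AB)
  then have "\<exists>C. C \<in> M \<and> C \<noteq> cl1 M" using AB by auto
  then have "cl2 M \<in> M \<and> cl2 M \<noteq> cl1 M" unfolding cl2_def by (rule someI_ex)
  then have c2: "cl2 M \<in> M" and ne: "cl1 M \<noteq> cl2 M" by auto
  have c: "cl1 M = A \<and> cl2 M = B \<or> cl1 M = B \<and> cl2 M = A"
    using c1 c2 ne unfolding AB(1) by (metis empty_iff insert_iff)
  then show "cl1 M \<in> P" "cl2 M \<in> P" using AB by auto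
  show "cl1 M \<noteq> cl2 M" by (rule ne)
  have "M = {A, B}" by (rule AB(1))
  also have "\<dots> = {cl1 M, cl2 M}" using c by (elim disjE conjE) (simp_all only: insert_commute)
  finally show "M = {cl1 M, cl2 M}" .
qed

lemma finite_extensions: "finite (extensions k (ms :: 'n::finite set set list))"
  by (induction k arbitrary: ms) auto

lemma extensions_prefix: "m \<in> extensions k ms \<Longrightarrow> take (length ms) m = ms \<and> length m = length ms + k"
proof (induction k arbitrary: ms)
  case (Suc k)
  then obtain M where "m \<in> extensions k (ms @ [M])" by auto
  from Suc.IH[OF this] have "take (Suc (length ms)) m = ms @ [M]" "length m = length ms + Suc k" by auto
  moreover have "take (length ms) m = take (length ms) (take (Suc (length ms)) m)" by (simp add: min_def)
  ultimately show ?case by simp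
qed simp

lemma valid_prefix_mem_extensions:
  "valid_prefix m \<Longrightarrow> j + k = length m \<Longrightarrow> m \<in> extensions k (take j m)"
proof (induction k arbitrary: j)
  case (Suc k)
  then have j: "j < length m" by auto
  have "m \<in> extensions k (take (Suc j) m)" using Suc by auto
  moreover have "take (Suc j) m = take j m @ [m ! j]" using j by (rule take_Suc_conv_app_nth)
  moreover have "m ! j \<in> cands (parts (take j m) (length (take j m)))"
    using Suc.prems j parts_cong[of j "take j m" m] by (auto simp: valid_prefix_def)
  ultimately show ?case by auto
qed simp

lemma valid_seqs_subset: "valid_seqs \<subseteq> extensions (CARD('n) - 1) ([] :: 'n::finite set set list)"
proof
  fix m :: "'n set set list" assume "m \<in> valid_seqs"
  then have "valid_prefix m" "length m = CARD('n) - 1" by (auto simp: valid_seqs_def valid_prefix_def)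
  then show "m \<in> extensions (CARD('n) - 1) []"
    using valid_prefix_mem_extensions[of m 0 "CARD('n) - 1"] by simp
qed

text \<open>Subadditivity holds for overlapping sets, so the subtrees below different merges never
  have to be shown disjoint.\<close>

lemma sum_UN_le_ennreal:
  fixes f :: "'a \<Rightarrow> ennreal"
  assumes "finite I"
  shows "sum f (\<Union>i\<in>I. A i) \<le> (\<Sum>i\<in>I. sum f (A i))"
  using assms
proof (induction I)
  case (insert i I)
  have "sum f (A i \<union> (\<Union>i\<in>I. A i)) \<le> sum f (A i) + sum f (\<Union>i\<in>I. A i)"
  proof (cases "finite (A i \<union> (\<Union>i\<in>I. A i))")
    case True
    then have "sum f (A i \<union> (\<Union>i\<in>I. A i)) + sum f (A i \<inter> (\<Union>i\<in>I. A i)) = sum f (A i) + sum f (\<Union>i\<in>I. A i)"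
      by (intro sum.union_inter) auto
    then show ?thesis by (metis le_iff_add)
  qed simp
  also have "\<dots> \<le> sum f (A i) + (\<Sum>i\<in>I. sum f (A i))" by (intro add_left_mono insert.IH)
  finally show ?case using insert by simp
qed simp

lemma sum_extensions_le:
  fixes ms :: "'n::finite set set list" and f :: "'n set set list \<Rightarrow> ennreal"
  shows "sum f (extensions (Suc k) ms) \<le> (\<Sum>M\<in>cands (parts ms (length ms)). sum f (extensions k (ms @ [M])))"
  by (simp add: sum_UN_le_ennreal)

lemma seq_lik_cong:
  assumes "take t m = take t m'" "t \<le> length m" "t \<le> length m'"
  shows "seq_lik d tau m t x = seq_lik d tau m' t x"
  unfolding seq_lik_def
proof (rule prod.cong[OF refl])
  fix s assume s: "s \<in> {..<t}"
  then have "take s m = take s m'" using arg_cong[OF assms(1), of "take s"] by (simp add: min_def)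
  then have "parts m s = parts m' s" using s assms by (intro parts_cong) auto
  moreover have "m ! s = m' ! s" using s arg_cong[OF assms(1), of "\<lambda>l. l ! s"] by simp
  ultimately show "merge_prob d tau (parts m s) (m ! s) x = merge_prob d tau (parts m' s) (m' ! s) x" by simp
qed

lemma pvalue_cong:
  assumes "take t m = take t m'" "0 < t" "t \<le> length m" "t \<le> length m'"
  shows "pvalue d tau m t x = pvalue d tau m' t x"
proof -
  have "m ! (t - 1) = m' ! (t - 1)"
    using assms(2) arg_cong[OF assms(1), of "\<lambda>l. l ! (t - 1)"] by simp
  moreover have "Fcdf d tau m t N a r = Fcdf d tau m' t N a r" for N a r
    unfolding Fcdf_def by (simp add: seq_lik_cong[OF assms(1,3,4)])
  ultimately show ?thesis by (simp add: pvalue_def)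
qed

lemma seq_lik_snoc:
  "seq_lik d tau (ms @ [M]) (Suc (length ms)) x
     = seq_lik d tau ms (length ms) x * merge_prob d tau (parts ms (length ms)) M x"
proof -
  have "seq_lik d tau (ms @ [M]) (length ms) x = seq_lik d tau ms (length ms) x"
    by (rule seq_lik_cong) auto
  then show ?thesis by (simp add: seq_lik_def parts_append)
qed

lemma sum_seq_lik_snoc_le:
  fixes ms :: "'n::finite set set list"
  shows "(\<Sum>M\<in>cands (parts ms (length ms)). ennreal (seq_lik d tau (ms @ [M]) (Suc (length ms)) x))
    \<le> ennreal (seq_lik d tau ms (length ms) x)"
proof -
  have "(\<Sum>M\<in>cands (parts ms (length ms)). ennreal (seq_lik d tau (ms @ [M]) (Suc (length ms)) x))
     = ennreal (seq_lik d tau ms (length ms) x * (\<Sum>M\<in>cands (parts ms (length ms)). merge_prob d tau (parts ms (length ms)) M x))"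
    by (simp add: sum_ennreal seq_lik_nonneg seq_lik_snoc[symmetric] sum_distrib_left)
  also have "\<dots> \<le> ennreal (seq_lik d tau ms (length ms) x)"
    by (intro ennreal_leI mult_left_le merge_prob_sum_le_1 seq_lik_nonneg)
  finally show ?thesis .
qed

lemma sum_extensions_seq_lik_le:
  fixes ms :: "'n::finite set set list"
  shows "(\<Sum>m\<in>extensions k ms. ennreal (seq_lik d tau m (length ms + k) x)) \<le> ennreal (seq_lik d tau ms (length ms) x)"
proof (induction k arbitrary: ms)
  case (Suc k)
  have "(\<Sum>m\<in>extensions (Suc k) ms. ennreal (seq_lik d tau m (length ms + Suc k) x))
    \<le> (\<Sum>M\<in>cands (parts ms (length ms)). \<Sum>m\<in>extensions k (ms @ [M]). ennreal (seq_lik d tau m (length ms + Suc k) x))"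
    by (rule sum_extensions_le)
  also have "\<dots> \<le> (\<Sum>M\<in>cands (parts ms (length ms)). ennreal (seq_lik d tau (ms @ [M]) (Suc (length ms)) x))"
    using Suc.IH[of "ms @ [_]"] by (intro sum_mono) simp
  also have "\<dots> \<le> ennreal (seq_lik d tau ms (length ms) x)" by (rule sum_seq_lik_snoc_le)
  finally show ?case .
qed simp

text \<open>Cluster sizes and levels depend on the merges and not on the data, so one step is a
  Boolean combination of \<open>pv t x < a\<close> and the remaining run.\<close>

lemma spend_measurable:
  assumes [measurable]: "\<And>t. pv t \<in> borel_measurable M"
  shows "Measurable.pred M (\<lambda>x. spend (\<lambda>t. pv t x) m nmin nstar n k t S > K)"
proof (induction k arbitrary: t S)
  case (Suc k)
  note [measurable] = Suc.IH
  show ?case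
  proof (cases "min (card (cl1 (m ! (t - 1)))) (card (cl2 (m ! (t - 1)))) \<le> nmin")
    case True
    then show ?thesis by (simp add: Let_def)
  next
    case False
    define a where "a = (if int (min (card (cl1 (m ! (t - 1)))) (card (cl2 (m ! (t - 1))))) \<le> nstar
      then Min (set_mset S) else Max (set_mset S))"
    have "(\<lambda>x. spend (\<lambda>t. pv t x) m nmin nstar n (Suc k) t S > K)
      = (\<lambda>x. (pv t x < a \<and> n - t + 1 > K) \<or> (\<not> pv t x < a \<and> spend (\<lambda>t. pv t x) m nmin nstar n k (t + 1) (S - {#a#}) > K))"
      using False by (auto simp: Let_def a_def)
    then show ?thesis by simp
  qed
qed simp

lemma Kstar_pos: "Kstar (mu :: real^'p^'n) \<ge> 1"
  by (simp add: Kstar_def Suc_le_eq card_gt_0_iff)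

lemma sum_mset_nonneg_real: "(\<And>a. a \<in># S \<Longrightarrow> 0 \<le> a) \<Longrightarrow> 0 \<le> sum_mset (S :: real multiset)"
  by (induction S) (auto intro!: add_nonneg_nonneg)

section \<open>Charging rejections to the levels\<close>

locale spending =
  fixes mu :: "real^'p^'n::finite" and sig tau :: real
    and d :: "'n set set \<Rightarrow> real^'p^'n \<Rightarrow> real" and nmin :: nat and nstar :: int
  assumes sig: "sig > 0" and nmin: "nmin \<ge> 1"
    and d: "\<And>M. d M \<in> borel_measurable borel"
begin

text \<open>The joint density of the data and the first \<open>t\<close> merges of \<open>m\<close>,
  with respect to Lebesgue measure in the data.\<close>

definition mass :: "'n set set list \<Rightarrow> nat \<Rightarrow> real^'p^'n \<Rightarrow> ennreal" where
  "mass m t x = ennreal (seq_lik d tau m t x * gauss_density mu sig x)"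

text \<open>The event for a run resumed at step \<open>t\<close> with \<open>k\<close> steps and the
  levels \<open>S\<close> left. The condition on the merges does not involve \<open>x\<close>; it
  empties the set for sequences outside the event of the theorem.\<close>

definition overshoot :: "nat \<Rightarrow> nat \<Rightarrow> real multiset \<Rightarrow> 'n set set list \<Rightarrow> (real^'p^'n) set" where
  "overshoot k t S m =
     {x. spend (\<lambda>t. pvalue d tau m t x) m nmin nstar CARD('n) k t S > Kstar mu \<and> good_merges mu m}"

lemma mass_measurable[measurable]: "mass m t \<in> borel_measurable borel"
proof -
  have [measurable]: "seq_lik d tau m t \<in> borel_measurable borel" by (rule seq_lik_measurable) (rule d)
  show ?thesis unfolding mass_def by measurable
qed

lemma pvalue_meas[measurable]: "pvalue d tau m t \<in> borel_measurable borel"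
  by (rule pvalue_measurable) (rule d)

lemma overshoot_sets[measurable]: "overshoot k t S m \<in> sets borel"
proof -
  have [measurable]: "Measurable.pred borel
    (\<lambda>x. spend (\<lambda>t. pvalue d tau m t x) m nmin nstar CARD('n) k t S > Kstar mu)"
    by (rule spend_measurable) measurable
  have "{x \<in> space borel. spend (\<lambda>t. pvalue d tau m t x) m nmin nstar CARD('n) k t S > Kstar mu \<and> good_merges mu m} \<in> sets borel"
    by measurable
  then show ?thesis by (simp add: overshoot_def)
qed

lemma mass_eq: "mass m t x = ennreal (seq_lik d tau m t x) * ennreal (gauss_density mu sig x)"
  by (simp add: mass_def ennreal_mult seq_lik_nonneg gauss_density_nonneg)

lemma sum_extensions_mass_le: "(\<Sum>m\<in>extensions k ms. mass m (length ms + k) x) \<le> mass ms (length ms) x"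
  unfolding mass_eq sum_distrib_right[symmetric]
  by (intro mult_right_mono sum_extensions_seq_lik_le) simp

lemma sum_mass_snoc_le:
  "(\<Sum>M\<in>cands (parts ms (length ms)). mass (ms @ [M]) (Suc (length ms)) x) \<le> mass ms (length ms) x"
  unfolding mass_eq sum_distrib_right[symmetric]
  by (intro mult_right_mono sum_seq_lik_snoc_le) simp

text \<open>A merge inside one true cluster satisfies its null hypothesis, and a tested one has both
  sizes above \<open>nmin \<ge> 1\<close>, so the p-value bound applies at this node, before any
  later merge is made.\<close>

lemma rejection_mass_le:
  assumes val: "valid_prefix ms" and M: "M \<in> cands (parts ms (length ms))"
    and big: "min (card (cl1 M)) (card (cl2 M)) > nmin" and a: "a \<ge> 0"
    and good: "\<Union>M \<subseteq> {i. mu $ i = v}"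
  shows "(\<integral>\<^sup>+ x. indicator {x. pvalue d tau (ms @ [M]) (Suc (length ms)) x < a} x * mass (ms @ [M]) (Suc (length ms)) x \<partial>lborel)
    \<le> ennreal a * (\<integral>\<^sup>+ x. mass (ms @ [M]) (Suc (length ms)) x \<partial>lborel)"
proof -
  note cl = cl_cands[OF M]
  have "cl1 M \<inter> cl2 M = {}"
    by (rule valid_prefix_disjoint[OF val le_refl cl(1,2,3)])
  then interpret cluster_pair "cl1 M" "cl2 M"
    using big nmin by unfold_locales auto
  have "mu $ i = v" if "i \<in> cl1 M \<union> cl2 M" for i
    using good that cl(4) by blast
  then show ?thesis unfolding mass_def
    by (intro pvalue_superuniform sig d a) auto
qed

text \<open>A run that overshoots from this step on, but not from the next, must reject here. Its
  output \<open>n - length ms\<close> exceeds \<open>Kstar mu\<close> only if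
  \<open>length ms < n - Kstar mu\<close>, which is the zero-based range of
  \<open>good_merges\<close>.\<close>

lemma overshoot_tested:
  assumes m: "m \<in> extensions k (ms @ [M])" and big: "\<not> min (card (cl1 M)) (card (cl2 M)) \<le> nmin"
    and a: "a = (if int (min (card (cl1 M)) (card (cl2 M))) \<le> nstar then Min (set_mset S) else Max (set_mset S))"
    and x: "x \<in> overshoot (Suc k) (Suc (length ms)) S m" and nx: "x \<notin> overshoot k (Suc (Suc (length ms))) (S - {#a#}) m"
  shows "pvalue d tau (ms @ [M]) (Suc (length ms)) x < a" "length ms < CARD('n) - Kstar mu" "good_merges mu m"
proof -
  have pre: "take (Suc (length ms)) m = ms @ [M]" "length m = Suc (length ms) + k"
    using extensions_prefix[OF m] by auto
  have mM: "m ! length ms = M"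
    using pre by (metis lessI nth_append_length nth_take)
  have pv: "pvalue d tau m (Suc (length ms)) x = pvalue d tau (ms @ [M]) (Suc (length ms)) x"
    by (rule pvalue_cong) (use pre in auto)
  have "pvalue d tau m (Suc (length ms)) x < a \<and> CARD('n) - Suc (length ms) + 1 > Kstar mu"
    using x nx big unfolding overshoot_def by (auto simp: Let_def mM a[symmetric] split: if_splits)
  \<comment> \<open>Were the subtraction truncated to 0, the output would be 1, which does not
    exceed \<open>Kstar mu\<close>.\<close>
  moreover have "Kstar mu \<ge> 1" by (rule Kstar_pos)
  ultimately show "pvalue d tau (ms @ [M]) (Suc (length ms)) x < a" "length ms < CARD('n) - Kstar mu"
    by (auto simp: pv)
  show "good_merges mu m" using x by (simp add: overshoot_def)
qed

lemma overshoot_untested: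
  assumes m: "m \<in> extensions k (ms @ [M])" and small: "min (card (cl1 M)) (card (cl2 M)) \<le> nmin"
  shows "overshoot (Suc k) (Suc (length ms)) S m = overshoot k (Suc (Suc (length ms))) S m"
proof -
  have "take (Suc (length ms)) m = ms @ [M]"
    using extensions_prefix[OF m] by auto
  then have "m ! length ms = M"
    by (metis lessI nth_append_length nth_take)
  then show ?thesis using small by (simp add: overshoot_def Let_def)
qed

text \<open>Backward induction along the merge tree: at every node the remaining budget \<open>sum_mset S\<close> pays for
  all rejections below it, since a test at level \<open>a\<close> costs exactly the element \<open>a\<close> removed from \<open>S\<close>.\<close>

lemma overshoot_mass_le:
  assumes "valid_prefix ms" "length ms + k = CARD('n) - 1" "k \<le> size S" "\<And>a. a \<in># S \<Longrightarrow> a \<ge> 0"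
  shows "(\<integral>\<^sup>+ x. (\<Sum>m\<in>extensions k ms. indicator (overshoot k (Suc (length ms)) S m) x * mass m (CARD('n) - 1) x) \<partial>lborel)
    \<le> ennreal (sum_mset S) * (\<integral>\<^sup>+ x. mass ms (length ms) x \<partial>lborel)"
  using assms
proof (induction k arbitrary: ms S)
  case 0
  \<comment> \<open>With no steps left the output is 1, which cannot exceed
    \<open>Kstar mu\<close>.\<close>
  have "overshoot 0 (Suc (length ms)) S m = {}" for m
    using Kstar_pos[of mu] by (auto simp: overshoot_def)
  then show ?case by simp
next
  case (Suc k)
  let ?s = "length ms" and ?n = "CARD('n) - 1"
  let ?C = "cands (parts ms ?s)"
  have step: "(\<integral>\<^sup>+ x. (\<Sum>m\<in>extensions k (ms @ [M]). indicator (overshoot (Suc k) (Suc ?s) S m) x * mass m ?n x) \<partial>lborel)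
    \<le> ennreal (sum_mset S) * (\<integral>\<^sup>+ x. mass (ms @ [M]) (Suc ?s) x \<partial>lborel)" if M: "M \<in> ?C" for M
  proof -
    have val: "valid_prefix (ms @ [M])" by (rule valid_prefix_snoc) (use Suc.prems M in auto)
    show ?thesis
    proof (cases "min (card (cl1 M)) (card (cl2 M)) \<le> nmin")
      case True
      have "(\<integral>\<^sup>+ x. (\<Sum>m\<in>extensions k (ms @ [M]). indicator (overshoot (Suc k) (Suc ?s) S m) x * mass m ?n x) \<partial>lborel)
        = (\<integral>\<^sup>+ x. (\<Sum>m\<in>extensions k (ms @ [M]). indicator (overshoot k (Suc (length (ms @ [M]))) S m) x * mass m ?n x) \<partial>lborel)"
        using True by (simp add: overshoot_untested)
      also have "\<dots> \<le> ennreal (sum_mset S) * (\<integral>\<^sup>+ x. mass (ms @ [M]) (length (ms @ [M])) x \<partial>lborel)"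
        by (rule Suc.IH[OF val]) (use Suc.prems in auto)
      finally show ?thesis by simp
    next
      case False
      define a where "a = (if int (min (card (cl1 M)) (card (cl2 M))) \<le> nstar then Min (set_mset S) else Max (set_mset S))"
      \<comment> \<open>At least \<open>Suc k\<close> levels remain, so \<open>Min\<close> and
        \<open>Max\<close> return an element of \<open>S\<close>.\<close>
      have "S \<noteq> {#}" using Suc.prems(3) by auto
      then have aS: "a \<in># S" by (simp add: a_def)
      then have a0: "a \<ge> 0" using Suc.prems by auto
      define S' where "S' = S - {#a#}"
      have SS: "S = add_mset a S'" using aS by (simp add: S'_def)
      have S'0: "sum_mset S' \<ge> 0"
        using Suc.prems(4) by (intro sum_mset_nonneg_real) (simp add: SS)
      \<comment> \<open>This rejection event refers to the node \<open>ms @ [M]\<close> and not to a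
        leaf below it, so it factors out of the sum over leaves.\<close>
      define R where "R = {x. pvalue d tau (ms @ [M]) (Suc ?s) x < a \<and> ?s < CARD('n) - Kstar mu \<and> (\<exists>v. \<Union>M \<subseteq> {i. mu $ i = v})}"
      have R[measurable]: "R \<in> sets borel"
      proof -
        have "{x \<in> space borel. pvalue d tau (ms @ [M]) (Suc ?s) x < a \<and> ?s < CARD('n) - Kstar mu \<and> (\<exists>v. \<Union>M \<subseteq> {i. mu $ i = v})} \<in> sets borel"
          by measurable
        then show ?thesis by (simp add: R_def)
      qed
      have cover: "x \<in> R \<union> overshoot k (Suc (Suc ?s)) S' m"
        if m: "m \<in> extensions k (ms @ [M])" and x: "x \<in> overshoot (Suc k) (Suc ?s) S m" for x m
      proof (rule ccontr)
        assume "x \<notin> R \<union> overshoot k (Suc (Suc ?s)) S' m"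
        then have nR: "x \<notin> R" and nx: "x \<notin> overshoot k (Suc (Suc ?s)) (S - {#a#}) m" by (auto simp: S'_def)
        note t = overshoot_tested[OF m False a_def x nx]
        have "m ! ?s = M"
          using extensions_prefix[OF m] by (metis length_append_singleton lessI nth_append_length nth_take)
        then have "\<exists>v. \<Union>M \<subseteq> {i. mu $ i = v}"
          using t(2,3) by (auto simp: good_merges_def)
        with t nR show False by (simp add: R_def)
      qed
      have "(\<Sum>m\<in>extensions k (ms @ [M]). indicator (overshoot (Suc k) (Suc ?s) S m) x * mass m ?n x)
        \<le> indicator R x * mass (ms @ [M]) (Suc ?s) x
          + (\<Sum>m\<in>extensions k (ms @ [M]). indicator (overshoot k (Suc (Suc ?s)) S' m) x * mass m ?n x)" for x
      proof -
        have "(\<Sum>m\<in>extensions k (ms @ [M]). indicator (overshoot (Suc k) (Suc ?s) S m) x * mass m ?n x)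
          \<le> (\<Sum>m\<in>extensions k (ms @ [M]). indicator R x * mass m ?n x + indicator (overshoot k (Suc (Suc ?s)) S' m) x * mass m ?n x)"
          using cover by (intro sum_mono) (auto simp: indicator_def)
        also have "\<dots> = indicator R x * (\<Sum>m\<in>extensions k (ms @ [M]). mass m ?n x)
            + (\<Sum>m\<in>extensions k (ms @ [M]). indicator (overshoot k (Suc (Suc ?s)) S' m) x * mass m ?n x)"
          by (simp add: sum.distrib sum_distrib_left)
        also have "(\<Sum>m\<in>extensions k (ms @ [M]). mass m ?n x) \<le> mass (ms @ [M]) (Suc ?s) x"
          using sum_extensions_mass_le[of "ms @ [M]" k x] Suc.prems(2) by simp
        finally show ?thesis by (simp add: add_mono mult_left_mono)
      qed
      then have "(\<integral>\<^sup>+ x. (\<Sum>m\<in>extensions k (ms @ [M]). indicator (overshoot (Suc k) (Suc ?s) S m) x * mass m ?n x) \<partial>lborel)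
        \<le> (\<integral>\<^sup>+ x. indicator R x * mass (ms @ [M]) (Suc ?s) x
          + (\<Sum>m\<in>extensions k (ms @ [M]). indicator (overshoot k (Suc (Suc ?s)) S' m) x * mass m ?n x) \<partial>lborel)"
        by (intro nn_integral_mono)
      also have "\<dots> = (\<integral>\<^sup>+ x. indicator R x * mass (ms @ [M]) (Suc ?s) x \<partial>lborel)
          + (\<integral>\<^sup>+ x. (\<Sum>m\<in>extensions k (ms @ [M]). indicator (overshoot k (Suc (Suc ?s)) S' m) x * mass m ?n x) \<partial>lborel)"
        by (rule nn_integral_add) measurable
      also have "\<dots> \<le> ennreal a * (\<integral>\<^sup>+ x. mass (ms @ [M]) (Suc ?s) x \<partial>lborel)
          + ennreal (sum_mset S') * (\<integral>\<^sup>+ x. mass (ms @ [M]) (Suc ?s) x \<partial>lborel)"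
      proof (rule add_mono)
        show "(\<integral>\<^sup>+ x. indicator R x * mass (ms @ [M]) (Suc ?s) x \<partial>lborel)
          \<le> ennreal a * (\<integral>\<^sup>+ x. mass (ms @ [M]) (Suc ?s) x \<partial>lborel)"
        \<comment> \<open>An empty \<open>R\<close> costs nothing; otherwise its definition supplies
          the common mean \<open>v\<close> of the null hypothesis.\<close>
        proof (cases "R = {}")
          case False
          then obtain v where v: "\<Union>M \<subseteq> {i. mu $ i = v}" by (auto simp: R_def)
          have "(\<integral>\<^sup>+ x. indicator R x * mass (ms @ [M]) (Suc ?s) x \<partial>lborel)
            \<le> (\<integral>\<^sup>+ x. indicator {x. pvalue d tau (ms @ [M]) (Suc ?s) x < a} x * mass (ms @ [M]) (Suc ?s) x \<partial>lborel)"
            by (intro nn_integral_mono mult_right_mono) (auto simp: indicator_def R_def)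
          also have "\<dots> \<le> ennreal a * (\<integral>\<^sup>+ x. mass (ms @ [M]) (Suc ?s) x \<partial>lborel)"
            by (rule rejection_mass_le[OF Suc.prems(1) M _ a0 v])
              (use \<open>\<not> min (card (cl1 M)) (card (cl2 M)) \<le> nmin\<close> in \<open>simp only: not_le\<close>)
          finally show ?thesis .
        qed simp
        show "(\<integral>\<^sup>+ x. (\<Sum>m\<in>extensions k (ms @ [M]). indicator (overshoot k (Suc (Suc ?s)) S' m) x * mass m ?n x) \<partial>lborel)
          \<le> ennreal (sum_mset S') * (\<integral>\<^sup>+ x. mass (ms @ [M]) (Suc ?s) x \<partial>lborel)"
          using Suc.IH[OF val, of S'] Suc.prems by (auto simp: SS)
      qed
      \<comment> \<open>The level \<open>a\<close> spent here and the remaining budget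
        \<open>sum_mset S'\<close> add up to \<open>sum_mset S\<close>.\<close>
      also have "\<dots> = ennreal (sum_mset S) * (\<integral>\<^sup>+ x. mass (ms @ [M]) (Suc ?s) x \<partial>lborel)"
        using a0 S'0 by (simp add: SS distrib_right)
      finally show ?thesis .
    qed
  qed
  have "(\<integral>\<^sup>+ x. (\<Sum>m\<in>extensions (Suc k) ms. indicator (overshoot (Suc k) (Suc ?s) S m) x * mass m ?n x) \<partial>lborel)
    \<le> (\<integral>\<^sup>+ x. (\<Sum>M\<in>?C. \<Sum>m\<in>extensions k (ms @ [M]). indicator (overshoot (Suc k) (Suc ?s) S m) x * mass m ?n x) \<partial>lborel)"
    by (intro nn_integral_mono sum_extensions_le)
  also have "\<dots> = (\<Sum>M\<in>?C. \<integral>\<^sup>+ x. (\<Sum>m\<in>extensions k (ms @ [M]). indicator (overshoot (Suc k) (Suc ?s) S m) x * mass m ?n x) \<partial>lborel)"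
    by (rule nn_integral_sum) measurable
  also have "\<dots> \<le> (\<Sum>M\<in>?C. ennreal (sum_mset S) * (\<integral>\<^sup>+ x. mass (ms @ [M]) (Suc ?s) x \<partial>lborel))"
    by (intro sum_mono step)
  \<comment> \<open>The budget is the same for every \<open>M\<close>, so it leaves the sum; the
    masses of the children then add up to at most that of \<open>ms\<close>.\<close>
  also have "\<dots> = ennreal (sum_mset S) * (\<integral>\<^sup>+ x. (\<Sum>M\<in>?C. mass (ms @ [M]) (Suc ?s) x) \<partial>lborel)"
    by (simp add: nn_integral_sum sum_distrib_left)
  also have "\<dots> \<le> ennreal (sum_mset S) * (\<integral>\<^sup>+ x. mass ms ?s x \<partial>lborel)"
    by (intro mult_left_mono nn_integral_mono sum_mass_snoc_le) simp
  finally show ?case .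
qed

end

theorem theorem3:
  fixes mu :: "real^'p^'n" and sig tau alpha :: real
    and d :: "'n set set \<Rightarrow> real^'p^'n \<Rightarrow> real"
    and alphas :: "nat \<Rightarrow> real" and nmin :: nat and nstar :: int
  assumes "sig > 0" and "tau > 0" and "nmin \<ge> 1"
    and "\<And>M x. d M x \<ge> 0"
    and "\<And>M. d M \<in> borel_measurable borel"
    and "\<And>j. j \<in> {1..<CARD('n)} \<Longrightarrow> alphas j \<ge> 0"
    and "(\<Sum>j = 1..<CARD('n). alphas j) = alpha"
  shows "(\<integral>\<^sup>+ x. ennreal (alg_prob d tau x
            (\<lambda>m. Khat d tau alphas nmin nstar m x > Kstar mu \<and> good_merges mu m))
          \<partial>gauss_data mu sig) \<le> ennreal alpha"
proof -
  interpret spending mu sig tau d nmin nstar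
    using assms by unfold_locales auto
  define S where "S = mset (map alphas [1..<CARD('n)])"
  let ?n = "CARD('n) - 1"
  let ?O = "overshoot ?n 1 S"
  have fin: "finite (valid_seqs :: 'n set set list set)"
    by (rule finite_subset[OF valid_seqs_subset finite_extensions])
  have sumS: "sum_mset S = alpha"
    unfolding S_def assms(7)[symmetric] by (simp add: sum_unfold_sum_mset)
  have seq[measurable]: "seq_lik d tau m t \<in> borel_measurable borel" for m t
    by (rule seq_lik_measurable) (rule assms)
  have alg: "alg_prob d tau x (\<lambda>m. Khat d tau alphas nmin nstar m x > Kstar mu \<and> good_merges mu m)
    = (\<Sum>m\<in>valid_seqs. indicator (?O m) x * seq_lik d tau m ?n x)" for x
  proof -
    have O: "(Khat d tau alphas nmin nstar m x > Kstar mu \<and> good_merges mu m) \<longleftrightarrow> x \<in> ?O m" for m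
      by (simp add: Khat_def overshoot_def S_def)
    show ?thesis unfolding alg_prob_def O
      by (intro sum.mono_neutral_cong_left fin) (auto simp: indicator_def)
  qed
  have "(\<integral>\<^sup>+ x. ennreal (alg_prob d tau x
            (\<lambda>m. Khat d tau alphas nmin nstar m x > Kstar mu \<and> good_merges mu m)) \<partial>gauss_data mu sig)
    = (\<integral>\<^sup>+ x. ennreal (gauss_density mu sig x) * ennreal (\<Sum>m\<in>valid_seqs. indicator (?O m) x * seq_lik d tau m ?n x) \<partial>lborel)"
    unfolding alg gauss_data_eq by (rule nn_integral_density) measurable
  also have "\<dots> = (\<integral>\<^sup>+ x. (\<Sum>m\<in>valid_seqs. indicator (?O m) x * mass m ?n x) \<partial>lborel)"
    unfolding mass_eq
    by (intro nn_integral_cong)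
      (simp add: sum_ennreal[symmetric] seq_lik_nonneg sum_distrib_left ennreal_mult ennreal_indicator mult_ac)
  also have "\<dots> \<le> (\<integral>\<^sup>+ x. (\<Sum>m\<in>extensions ?n []. indicator (?O m) x * mass m ?n x) \<partial>lborel)"
    by (intro nn_integral_mono sum_mono2 finite_extensions valid_seqs_subset) auto
  also have "\<dots> \<le> ennreal (sum_mset S) * (\<integral>\<^sup>+ x. mass [] 0 x \<partial>lborel)"
  proof -
    have "a \<ge> 0" if "a \<in># S" for a
      using that assms(6) by (auto simp: S_def)
    then show ?thesis
      using overshoot_mass_le[of "[]" ?n S] by (simp add: S_def valid_prefix_def)
  qed
  \<comment> \<open>At the root no merge has been made, so the mass is the Gaussian density
    itself.\<close>
  also have "(\<integral>\<^sup>+ x. mass [] 0 x \<partial>lborel) = 1"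
    by (simp add: mass_def seq_lik_def nn_integral_gauss_density assms)
  finally show ?thesis by (simp add: sumS)
qed

end
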